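(* Let $k\geq 3$ and $n\geq 1$ be integers. Let $\mathcal{S}_n(12\ldots k(k-1))$ denote the set of permutations of $[n]=\{1,\ldots,n\}$ avoiding the pattern $12\ldots (k-2)\,k\,(k-1)$, and $\mathcal{S}_n(23\ldots k1)$ the set of permutations of $[n]$ avoiding the pattern $23\ldots k\,1$. Then there exists a bijection $\Theta:\mathcal{S}_n(12\ldots k(k-1))\to \mathcal{S}_n(23\ldots k1)$ such that $\mathcal{D}(\Theta(\pi))=\mathcal{D}(\pi)$ for every $\pi\in \mathcal{S}_n(12\ldots k(k-1))$.
   Context: A permutation $\pi=\pi_1\cdots\pi_n$ contains a pattern $\tau=\tau_1\cdots\tau_k\in\mathcal{S}_k$ if some subsequence $\pi_{i_1}\cdots\pi_{i_k}$ ($i_1<\cdots<i_k$) is order-isomorphic to $\tau$; otherwise it avoids $\tau$. The pattern $12\ldots k(k-1)$ denotes the permutation $1\,2\,\cdots\,(k-2)\,k\,(k-1)$ of length $k$, and $23\ldots k1$ denotes $2\,3\,\cdots\,k\,1$. The descent set of $\pi$ is $\mathcal{D}(\pi)=\{i : \pi_i>\pi_{i+1}\}$. *)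

theory Defs
  imports "HOL-Combinatorics.Permutations"
begin

text \<open>A permutation of \<open>{1..n}\<close> is a function \<open>\<pi>\<close> with \<open>\<pi> permutes {1..n}\<close>; it is the identity
  outside \<open>{1..n}\<close>, so such functions correspond exactly to the words \<open>\<pi> 1, \<dots>, \<pi> n\<close>.\<close>

definition contains_pattern :: "nat \<Rightarrow> (nat \<Rightarrow> nat) \<Rightarrow> nat \<Rightarrow> (nat \<Rightarrow> nat) \<Rightarrow> bool" where
  "contains_pattern n \<pi> k \<tau> \<longleftrightarrow>
     (\<exists>i. strict_mono_on {1..k} i \<and> i ` {1..k} \<subseteq> {1..n} \<and>
          (\<forall>a\<in>{1..k}. \<forall>b\<in>{1..k}. \<pi> (i a) < \<pi> (i b) \<longleftrightarrow> \<tau> a < \<tau> b))"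

definition avoiders :: "nat \<Rightarrow> nat \<Rightarrow> (nat \<Rightarrow> nat) \<Rightarrow> (nat \<Rightarrow> nat) set" where
  "avoiders n k \<tau> = {\<pi>. \<pi> permutes {1..n} \<and> \<not> contains_pattern n \<pi> k \<tau>}"

text \<open>The pattern \<open>1 2 \<dots> (k-2) k (k-1)\<close>.\<close>

definition pattern_swap_last :: "nat \<Rightarrow> nat \<Rightarrow> nat" where
  "pattern_swap_last k i = (if i = k - 1 then k else if i = k then k - 1 else i)"

text \<open>The pattern \<open>2 3 \<dots> k 1\<close>.\<close>

definition pattern_shift :: "nat \<Rightarrow> nat \<Rightarrow> nat" where
  "pattern_shift k i = (if 1 \<le> i \<and> i < k then i + 1 else if i = k then 1 else i)"

text \<open>Positions are restricted to \<open>1 \<le> i < n\<close>, since \<open>\<pi> (n + 1)\<close> is not part of the word.\<close>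

definition descent_set :: "nat \<Rightarrow> (nat \<Rightarrow> nat) \<Rightarrow> nat set" where
  "descent_set n \<pi> = {i. 1 \<le> i \<and> i < n \<and> \<pi> i > \<pi> (i + 1)}"

lemma pattern_swap_last_permutes:
  assumes "2 \<le> k"
  shows "pattern_swap_last k permutes {1..k}"
proof (rule bij_imp_permutes)
  show "bij_betw (pattern_swap_last k) {1..k} {1..k}"
    by (rule bij_betw_byWitness[where f' = "pattern_swap_last k"])
      (use assms in \<open>auto simp: pattern_swap_last_def\<close>)
qed (use assms in \<open>auto simp: pattern_swap_last_def\<close>)

lemma pattern_shift_permutes:
  assumes "1 \<le> k"
  shows "pattern_shift k permutes {1..k}"
proof (rule bij_imp_permutes)
  show "bij_betw (pattern_shift k) {1..k} {1..k}"
    by (rule bij_betw_byWitness[where f' = "\<lambda>i. if i = 1 then k else i - 1"])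
      (use assms in \<open>auto simp: pattern_shift_def\<close>)
qed (use assms in \<open>auto simp: pattern_shift_def\<close>)

lemma pattern_one_line_examples:
  "map (pattern_swap_last 5) [1, 2, 3, 4, 5] = [1, 2, 3, 5, 4]"
  "map (pattern_shift 5) [1, 2, 3, 4, 5] = [2, 3, 4, 5, 1]"
  by (simp_all add: pattern_swap_last_def pattern_shift_def)

end

theory Submission
  imports Defs "HOL-Library.Sublist" "HOL-Library.Multiset" "HOL-Library.Equipollence"
begin

text \<open>
  By inclusion--exclusion it suffices to compare, for every set \<open>S\<close>, the avoiders whose descent set
  is contained in \<open>S\<close>. Cutting the positions at \<open>S\<close> into blocks and recording for every value the
  block containing it turns such a permutation into a word of fixed content. Under this encoding
  \<open>1 2 \<dots> k (k-1)\<close> becomes \<open>u\<^sub>1 \<le> \<dots> \<le> u\<^sub>r \<le> a < b\<close> in the order \<open>u\<^sub>1 \<dots> u\<^sub>r b a\<close> with \<open>r = k - 2\<close>, and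
  \<open>2 3 \<dots> k 1\<close> becomes a letter followed by \<open>k - 1\<close> smaller, weakly increasing letters.

  In the first pattern \<open>b a\<close> can be replaced by \<open>a b\<close>: given the letters that do not end a chain
  of length \<open>r + 1\<close>, the remaining ones have to be placed greedily, the smallest (respectively
  largest) admissible one first, and whether this is possible only depends on how many there are.
  Reversing the word gives a letter followed by \<open>k - 1\<close> smaller, weakly decreasing letters.

  Finally weakly decreasing is exchanged for weakly increasing by reading a word from right to left
  into a semistandard tableau, by row and by column insertion respectively, and
  discarding the letters not smaller than the maximum of the unread part. Both insertions are
  reversible for every choice of the new box, so the number of words leading to a given tableau only
  depends on its shape, and in both cases the forbidden chain amounts to too long a first row.
\<close>


section \<open>Reversible insertion into tableaux\<close>

text \<open>A letter smaller than an earlier one never has to be tested as the large letter of a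
  forbidden chain: the earlier one would serve as well. Only left-to-right maxima matter, each
  tested against a tableau of the smaller letters to its right, so the bound of the tableau changes
  along the word. The tableau that remains no longer shows what was discarded when the bound
  dropped; but how often a discarded value occurred is a difference of sizes of two levels. Hence
  tableaux are stored as sequences of shapes, where discarding large letters removes the head of the
  list. Undoing the two insertions at the same corner need not give the same letter or the same
  tableau; only the shapes agree. The comparison is therefore an induction on word length over all
  pairs of tableaux of equal shape, matching fibres by \<open>\<approx>\<close> instead of giving
  one explicit map. What makes it work is local: from the new box of one level it can be decided, in
  exactly one way, whether and where the next smaller level grew.\<close>

definition is_shape :: "(nat \<Rightarrow> nat) \<Rightarrow> bool" where
  "is_shape f \<longleftrightarrow> antimono f \<and> (\<exists>c. f c = 0)"

definition strip :: "(nat \<Rightarrow> nat) \<Rightarrow> (nat \<Rightarrow> nat) \<Rightarrow> bool" where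
  "strip f g \<longleftrightarrow> (\<forall>c. f c \<le> g c \<and> g c \<le> Suc (f c))"

definition bump :: "(nat \<Rightarrow> nat) \<Rightarrow> nat \<Rightarrow> nat \<Rightarrow> nat" where
  "bump f j = f(j := Suc (f j))"

text \<open>A semistandard tableau is encoded by a list of shapes, the largest one first: the shape followed
  by \<open>v - 1\<close> others consists of the boxes with an entry below \<open>v\<close>. Shapes are given by their column
  heights, and columns strictly increase iff each shape exceeds the next one by at most one box per column.\<close>

fun top_shape :: "(nat \<Rightarrow> nat) list \<Rightarrow> nat \<Rightarrow> nat" where
  "top_shape [] = (\<lambda>_. 0)"
| "top_shape (g # T) = g"

fun gt_pattern :: "(nat \<Rightarrow> nat) list \<Rightarrow> bool" where
  "gt_pattern [] \<longleftrightarrow> True"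
| "gt_pattern (g # T) \<longleftrightarrow> is_shape g \<and> strip (top_shape T) g \<and> gt_pattern T"

lemma part_zero: "is_shape (\<lambda>_. 0)"
  by (simp add: is_shape_def antimono_def)

lemma gt_part: "gt_pattern T \<Longrightarrow> is_shape (top_shape T)"
  by (cases T) (auto simp: part_zero)

lemma bump_simps: "bump f j c = (if c = j then Suc (f j) else f c)"
  by (simp add: bump_def)

lemma bump_inj: "bump f i = bump f j \<Longrightarrow> i = j"
  by (metis bump_def fun_upd_apply n_not_Suc_n)

lemma part_antimono: "is_shape f \<Longrightarrow> c \<le> d \<Longrightarrow> f d \<le> f c"
  by (auto simp: is_shape_def antimono_def)

lemma part_bump_iff: "is_shape f \<Longrightarrow> is_shape (bump f j) \<longleftrightarrow> (\<forall>c<j. f j < f c)"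
proof
  assume "is_shape f" and p: "is_shape (bump f j)"
  show "\<forall>c<j. f j < f c"
  proof (intro allI impI)
    fix c assume "c < j"
    then show "f j < f c" using part_antimono[OF p, of c j] by (simp add: bump_simps)
  qed
next
  assume f: "is_shape f" and j: "\<forall>c<j. f j < f c"
  obtain c0 where c0: "f c0 = 0" using f by (auto simp: is_shape_def)
  have "f (max c0 (Suc j)) = 0" using part_antimono[OF f, of c0 "max c0 (Suc j)"] c0 by simp
  then have "bump f j (max c0 (Suc j)) = 0" by (auto simp: bump_def)
  moreover have "bump f j d \<le> bump f j c" if "c \<le> d" for c d
    using j part_antimono[OF f that] that by (auto simp: bump_simps Suc_le_eq le_less)
  ultimately show "is_shape (bump f j)" unfolding is_shape_def antimono_def by blast
qed

text \<open>Inserting \<open>x\<close> adds one box to every shape on a level above \<open>x\<close>. For consecutive shapes \<open>f\<close>, \<open>g\<close>,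
  \<open>start\<close> is the column of the new box of \<open>g\<close> on the first of these levels, where \<open>f\<close> is unchanged,
  and \<open>step\<close> computes it from the column \<open>i\<close> of the box added to \<open>f\<close>. In \<open>reverse\<close>, the shape \<open>f\<close> is
  the one after the insertion.\<close>

locale insertion =
  fixes start :: "(nat \<Rightarrow> nat) \<Rightarrow> (nat \<Rightarrow> nat) \<Rightarrow> nat"
    and step :: "(nat \<Rightarrow> nat) \<Rightarrow> (nat \<Rightarrow> nat) \<Rightarrow> nat \<Rightarrow> nat"
  assumes start_ok: "is_shape f \<Longrightarrow> is_shape g \<Longrightarrow> strip f g \<Longrightarrow>
      is_shape (bump g (start f g)) \<and> strip f (bump g (start f g))"
    and step_ok: "is_shape f \<Longrightarrow> is_shape (bump f i) \<Longrightarrow> is_shape g \<Longrightarrow> strip f g \<Longrightarrow>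
      is_shape (bump g (step f g i)) \<and> strip (bump f i) (bump g (step f g i))"
    and reverse: "is_shape f \<Longrightarrow> is_shape g \<Longrightarrow> is_shape (bump g j) \<Longrightarrow> strip f (bump g j) \<Longrightarrow>
      \<exists>!p. case p of None \<Rightarrow> strip f g \<and> start f g = j
        | Some (f', i) \<Rightarrow> is_shape f' \<and> bump f' i = f \<and> strip f' g \<and> step f' g i = j"
begin

text \<open>Column of the box gained by the largest shape. The head of \<open>g # T\<close> counts
  entries up to \<open>length T\<close>, so \<open>x = length T\<close> marks the first level that
  sees the letter.\<close>

fun carry :: "nat \<Rightarrow> (nat \<Rightarrow> nat) list \<Rightarrow> nat" where
  "carry x [] = 0"
| "carry x (g # T) = (if x < length T then step (top_shape T) g (carry x T) else start (top_shape T) g)"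

fun insert_letter :: "nat \<Rightarrow> (nat \<Rightarrow> nat) list \<Rightarrow> (nat \<Rightarrow> nat) list" where
  "insert_letter x [] = []"
| "insert_letter x (g # T) = bump g (carry x (g # T)) # (if x < length T then insert_letter x T else T)"

lemma length_ins [simp]: "length (insert_letter x T) = length T"
  by (induction T) auto

lemma top_ins: "T \<noteq> [] \<Longrightarrow> top_shape (insert_letter x T) = bump (top_shape T) (carry x T)"
  by (cases T) auto

lemma gt_ins: "gt_pattern T \<Longrightarrow> gt_pattern (insert_letter x T)"
proof (induction T)
  case (Cons g T)
  show ?case
  proof (cases "x < length T")
    case True
    then have "T \<noteq> []" by auto
    have p: "is_shape (bump (top_shape T) (carry x T))"
      using gt_part[of "insert_letter x T"] Cons True top_ins[OF \<open>T \<noteq> []\<close>, of x] by auto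
    show ?thesis
      using Cons True step_ok[OF gt_part[of T] p, of g] top_ins[OF \<open>T \<noteq> []\<close>, of x] by auto
  next
    case False
    then show ?thesis using Cons start_ok[OF gt_part[of T], of g] by auto
  qed
qed auto

text \<open>Undoes an insertion whose new corner is prescribed: \<open>reverse\<close> is applied
  from the largest level downwards, and the level at which it yields \<open>None\<close> is the
  inserted letter.\<close>

lemma unins:
  assumes "gt_pattern T" "is_shape g" "bump g j = top_shape T"
  shows "\<exists>!p. fst p < length T \<and> gt_pattern (snd p) \<and> length (snd p) = length T \<and>
    top_shape (snd p) = g \<and> insert_letter (fst p) (snd p) = T"
  using assms
proof (induction T arbitrary: g j)
  \<comment> \<open>The zero shape is no \<open>bump\<close>, so \<open>reverse\<close> must yield
    \<open>None\<close> before the levels run out.\<close>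
  case Nil
  then show ?case by (metis bump_simps nat.distinct(1) top_shape.simps(1))
next
  case (Cons h T)
  let ?f = "top_shape T"
  have h: "h = bump g j" using Cons.prems by simp
  have f: "is_shape ?f" using Cons.prems gt_part by auto
  let ?P = "\<lambda>p. case p of None \<Rightarrow> strip ?f g \<and> start ?f g = j
        | Some (f', i) \<Rightarrow> is_shape f' \<and> bump f' i = ?f \<and> strip f' g \<and> step f' g i = j"
  let ?Q = "\<lambda>p. fst p < length (h # T) \<and> gt_pattern (snd p) \<and> length (snd p) = length (h # T) \<and>
    top_shape (snd p) = g \<and> insert_letter (fst p) (snd p) = h # T"
  have "\<exists>!p. ?P p"
    using reverse[OF f, of g j] Cons.prems by auto
  then obtain p where p: "?P p" and pu: "\<And>q. ?P q \<Longrightarrow> q = p" by blast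
  \<comment> \<open>Every preimage of \<open>h # T\<close> with top shape \<open>g\<close> gives a
    solution of \<open>?P\<close>, so uniqueness of \<open>p\<close> fixes both its kind and the box
    to undo one level below.\<close>
  have Q: "?P (if x = length T then None else Some (top_shape T', carry x T')) \<and> 
      (if x = length T then T' = T else x < length T \<and> insert_letter x T' = T \<and> gt_pattern T' \<and> length T' = length T)"
    if q: "?Q (x, g # T')" for x T'
  proof (cases "x = length T")
    case True
    then show ?thesis using q h by (auto dest: bump_inj)
  next
    case False
    with q have x: "x < length T" and l: "length T' = length T" by auto
    then have "T' \<noteq> []" by auto
    have "insert_letter x T' = T" using q x l by simp
    then show ?thesis using False q h x l top_ins[OF \<open>T' \<noteq> []\<close>, of x] gt_part[of T']
      by (auto dest: bump_inj)
  qed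
  show ?case
  proof (cases p)
    case None
    have "?Q (length T, g # T)" using None p Cons.prems(1,2) h by auto
    moreover have "q = (length T, g # T)" if "?Q q" for q
    proof -
      obtain x U where q: "q = (x, U)" by (cases q)
      with that obtain T' where U: "U = g # T'" by (cases U) auto
      have y: "?Q (x, g # T')" using that unfolding q U .
      have "(if x = length T then None else Some (top_shape T', carry x T')) = p"
        using Q[OF y] by (intro pu) (rule conjunct1)
      then have "x = length T" using None by (auto split: if_splits)
      then show ?thesis using Q[OF y] q U by simp
    qed
    ultimately show ?thesis by blast
  next
    case (Some fi)
    obtain f' i where fi: "fi = (f', i)" by (cases fi)
    have P: "is_shape f'" "bump f' i = ?f" "strip f' g" "step f' g i = j" using p Some fi by auto
    have "\<exists>!p. fst p < length T \<and> gt_pattern (snd p) \<and> length (snd p) = length T \<and>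
    top_shape (snd p) = f' \<and> insert_letter (fst p) (snd p) = T"
      using Cons.IH[of f' i] Cons.prems P by auto
    then obtain r where r: "fst r < length T \<and> gt_pattern (snd r) \<and> length (snd r) = length T \<and>
    top_shape (snd r) = f' \<and> insert_letter (fst r) (snd r) = T"
     and ru: "\<And>q. fst q < length T \<and> gt_pattern (snd q) \<and> length (snd q) = length T \<and>
    top_shape (snd q) = f' \<and> insert_letter (fst q) (snd q) = T \<Longrightarrow> q = r" by blast
    obtain x T' where xT: "r = (x, T')" by (cases r)
    have "T' \<noteq> []" using r xT by auto
    then have "bump f' (carry x T') = bump f' i" using r xT P top_ins[of T' x] by auto
    then have c: "carry x T' = i" by (rule bump_inj)
    have "?Q (x, g # T')" using r xT P c Cons.prems(1,2) h by auto
    moreover have "q = (x, g # T')" if "?Q q" for q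
    proof -
      obtain y U where q: "q = (y, U)" by (cases q)
      with that obtain T'' where U: "U = g # T''" by (cases U) auto
      have y: "?Q (y, g # T'')" using that unfolding q U .
      have "(if y = length T then None else Some (top_shape T'', carry y T'')) = p"
        using Q[OF y] by (intro pu) (rule conjunct1)
      then have "y \<noteq> length T" "Some (top_shape T'', carry y T'') = p"
        using Some by (auto split: if_splits)
      then have "top_shape T'' = f'" using Some fi by simp
      then have "(y, T'') = r" using Q[OF y] \<open>y \<noteq> length T\<close> by (intro ru) auto
      then show ?thesis using q U xT by auto
    qed
    ultimately show ?thesis by blast
  qed
qed

end

text \<open>Row insertion either keeps the column of the new box or, if the box is taken, puts the bumped entry
  at the end of the next row, that is, in the first column of the same height. Column insertion
  bumps the entry to the right, past all columns that contain the same letter.\<close>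

definition row_start :: "(nat \<Rightarrow> nat) \<Rightarrow> (nat \<Rightarrow> nat) \<Rightarrow> nat" where
  "row_start f g = (LEAST c. g c = 0)"

definition row_step :: "(nat \<Rightarrow> nat) \<Rightarrow> (nat \<Rightarrow> nat) \<Rightarrow> nat \<Rightarrow> nat" where
  "row_step f g i = (LEAST c. g c = g i)"

definition col_step :: "(nat \<Rightarrow> nat) \<Rightarrow> (nat \<Rightarrow> nat) \<Rightarrow> nat \<Rightarrow> nat" where
  "col_step f g i = (LEAST c. i \<le> c \<and> g c = f c)"

definition col_start :: "(nat \<Rightarrow> nat) \<Rightarrow> (nat \<Rightarrow> nat) \<Rightarrow> nat" where
  "col_start f g = col_step f g 0"


section \<open>Local rules of row and column insertion\<close>

lemma stripD: "strip f g \<Longrightarrow> f c \<le> g c" "strip f g \<Longrightarrow> g c \<le> Suc (f c)"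
  by (auto simp: strip_def)

lemma part_decr:
  assumes "is_shape f" "\<And>c. i < c \<Longrightarrow> f c \<le> m" "m \<le> f i"
  shows "is_shape (f(i := m))"
proof -
  obtain c0 where c0: "f c0 = 0" using assms by (auto simp: is_shape_def)
  have "f (max c0 (Suc i)) = 0" using part_antimono[OF assms(1), of c0 "max c0 (Suc i)"] c0 by simp
  then have "(f(i := m)) (max c0 (Suc i)) = 0" by auto
  moreover have "antimono (f(i := m))"
    unfolding antimono_def
    using assms(2,3) part_antimono[OF assms(1)] by (auto intro: order_trans)
  ultimately show ?thesis unfolding is_shape_def by blast
qed

lemma row_step_props:
  assumes "is_shape g"
  shows "row_step f g i \<le> i" "g (row_step f g i) = g i"
    "c < row_step f g i \<Longrightarrow> g i < g c"
proof -
  show 1: "row_step f g i \<le> i" and 2: "g (row_step f g i) = g i"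
    unfolding row_step_def by (auto intro: Least_le LeastI)
  assume c: "c < row_step f g i"
  then have "g c \<noteq> g i" unfolding row_step_def by (rule not_less_Least)
  moreover have "g i \<le> g c" using part_antimono[OF assms, of c i] c 1 by simp
  ultimately show "g i < g c" by simp
qed

lemma row_start_props:
  assumes "is_shape g"
  shows "g (row_start f g) = 0" "c < row_start f g \<Longrightarrow> 0 < g c"
  using assms unfolding row_start_def is_shape_def
  by (auto intro: LeastI_ex) (use not_less_Least in blast)

lemma col_step_props:
  assumes "is_shape f" "is_shape g" "strip f g"
  shows "i \<le> col_step f g i" "g (col_step f g i) = f (col_step f g i)"
    "i \<le> c \<Longrightarrow> c < col_step f g i \<Longrightarrow> g c = Suc (f c)"
proof -
  obtain c0 where c0: "g c0 = 0" using assms by (auto simp: is_shape_def)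
  have "g (max c0 i) = 0" using part_antimono[OF assms(2), of c0 "max c0 i"] c0 by simp
  then have ex: "i \<le> max c0 i \<and> g (max c0 i) = f (max c0 i)"
    using stripD(1)[OF assms(3), of "max c0 i"] by simp
  show "i \<le> col_step f g i" "g (col_step f g i) = f (col_step f g i)"
    unfolding col_step_def using LeastI[of "\<lambda>c. i \<le> c \<and> g c = f c", OF ex] by auto
  assume "i \<le> c" "c < col_step f g i"
  then have "g c \<noteq> f c" unfolding col_step_def using not_less_Least by blast
  then show "g c = Suc (f c)" using stripD[OF assms(3), of c] by simp
qed

lemma row_step_eqI: "g i = g j \<Longrightarrow> (\<And>c. c < j \<Longrightarrow> g c \<noteq> g j) \<Longrightarrow> row_step f g i = j"
  unfolding row_step_def by (intro Least_equality) (auto simp: not_less[symmetric])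

lemma col_step_eqI: "i \<le> j \<Longrightarrow> g j = f j \<Longrightarrow> (\<And>c. i \<le> c \<Longrightarrow> c < j \<Longrightarrow> g c \<noteq> f c) \<Longrightarrow> col_step f g i = j"
  unfolding col_step_def by (intro Least_equality) (auto simp: not_less[symmetric])

lemma row_insertion: "insertion row_start row_step"
proof
  fix f g :: "nat \<Rightarrow> nat"
  assume a: "is_shape f" "is_shape g" "strip f g"
  let ?j = "row_start f g"
  show "is_shape (bump g ?j) \<and> strip f (bump g ?j)"
    using row_start_props[OF a(2), where f = f] a stripD(1)[OF a(3), of ?j]
    by (auto simp: part_bump_iff strip_def bump_simps intro: le_SucI)
next
  fix f g :: "nat \<Rightarrow> nat" and i
  assume a: "is_shape f" "is_shape (bump f i)" "is_shape g" "strip f g"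
  let ?j = "row_step f g i"
  note p = row_step_props[OF a(3), where f = f and i = i]
  have "is_shape (bump g ?j)" using p a by (auto simp: part_bump_iff)
  moreover have "strip (bump f i) (bump g ?j)"
  proof (cases "?j = i")
    case True
    then show ?thesis using a(4) by (auto simp: strip_def bump_simps)
  next
    case False
    then have "?j < i" using p by simp
    then have "f i < f ?j" using a(1,2) by (simp add: part_bump_iff)
    moreover have "f ?j \<le> g ?j" "g i \<le> Suc (f i)" using a(4) by (auto simp: strip_def)
    ultimately have "g i = Suc (f i)" "f ?j = Suc (f i)" using p(2) by linarith+
    then show ?thesis using a(4) p(2) False by (auto simp: strip_def bump_simps)
  qed
  ultimately show "is_shape (bump g ?j) \<and> strip (bump f i) (bump g ?j)" ..
next
  fix f g :: "nat \<Rightarrow> nat" and j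
  assume a: "is_shape f" "is_shape g" "is_shape (bump g j)" "strip f (bump g j)"
  have lt: "g j < g c" if "c < j" for c using a that by (simp add: part_bump_iff)
  have fj: "f j \<le> Suc (g j)" "g j \<le> f j"
    using stripD[OF a(4), of j] by (auto simp: bump_simps)
  have fc: "f c \<le> g c" "g c \<le> Suc (f c)" if "c \<noteq> j" for c
    using stripD[OF a(4), of c] that by (auto simp: bump_simps)
  let ?P = "\<lambda>p. case p of None \<Rightarrow> strip f g \<and> row_start f g = j
        | Some (f', i) \<Rightarrow> is_shape f' \<and> bump f' i = f \<and> strip f' g \<and> row_step f' g i = j"
  have some: "is_shape f'" "f = bump f' i" "strip f' g" "j \<le> i" "g i = g j" if "?P (Some (f', i))" for f' i
    using that row_step_props(1,2)[OF a(2), where f = f' and i = i] by auto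
  \<comment> \<open>The new box of \<open>g\<close> either lies in \<open>f\<close> already, or it
    holds the letter separating the two levels: inserted directly if the box is in the first row,
    bumped out of the row above otherwise.\<close>
  consider "f j = Suc (g j)" | "f j = g j" "g j = 0" | "f j = g j" "g j > 0" using fj by linarith
  then show "\<exists>!p. ?P p"
  proof cases
    case 1
    show ?thesis
    proof (rule ex1I[where a = "Some (f(j := g j), j)"])
      have "f c \<le> g j" if "j < c" for c
        using fc[of c] part_antimono[OF a(2), of j c] that by simp
      then have "is_shape (f(j := g j))" using a(1) 1 by (intro part_decr) auto
      moreover have "row_step (f(j := g j)) g j = j" by (rule row_step_eqI[OF refl]) (use lt in \<open>metis less_irrefl\<close>)
      ultimately show "?P (Some (f(j := g j), j))"
        using 1 fc by (auto simp: bump_def strip_def)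
    next
      fix p assume p: "?P p"
      show "p = Some (f(j := g j), j)"
      proof (cases p)
        case None
        then show ?thesis using p stripD(1)[of f g j] 1 by auto
      next
        case (Some q)
        obtain f' i where q: "q = (f', i)" by (cases q)
        note s = some[of f' i, OF p[unfolded Some q]]
        have "i = j" using stripD(1)[OF s(3), of j] 1 s(2) by (auto simp: bump_simps split: if_splits)
        then show ?thesis using Some q s 1 by (auto simp: bump_def)
      qed
    qed
  next
    case 2
    show ?thesis
    proof (rule ex1I[where a = None])
      have "row_start f g = j" unfolding row_start_def
        using 2 lt by (intro Least_equality) (auto simp: not_less[symmetric], force)
      then show "?P None" using 2 fc by (auto simp: strip_def) (metis le_SucI le_refl)+
    next
      fix p assume p: "?P p"
      show "p = None"
      proof (rule ccontr)
        assume "p \<noteq> None"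
        then obtain f' i where pf: "p = Some (f', i)" by auto
        note s = some[of f' i, OF p[unfolded pf]]
        have "f i \<le> f j" using part_antimono[OF a(1)] s by simp
        then show False using 2 s(2) by (simp add: bump_simps)
      qed
    qed
  next
    case 3
    obtain c0 where c0: "f c0 = 0" using a by (auto simp: is_shape_def)
    have bd: "c \<le> c0" if "f c = g j" for c
    proof (rule ccontr)
      assume "\<not> c \<le> c0"
      then have "f c \<le> f c0" by (intro part_antimono[OF a(1)]) simp
      then show False using c0 that 3 by simp
    qed
    \<comment> \<open>Row \<open>g j\<close> of \<open>f\<close> ends in column \<open>i\<close>.
      The bumped letter stood at the end of that row of \<open>g\<close>, so the box in column
      \<open>i\<close> is the one that displaced it.\<close>
    define i where "i = (GREATEST c. f c = g j)"
    have fi: "f i = g j" unfolding i_def using 3(1) bd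
      by (intro GreatestI_nat[where P = "\<lambda>c. f c = g j"]) auto
    have imax: "c \<le> i" if "f c = g j" for c
      unfolding i_def using bd that
      by (intro Greatest_le_nat[where P = "\<lambda>c. f c = g j"]) auto
    have ji: "j \<le> i" using imax 3 by simp
    have after: "f c < g j" if "i < c" for c
      using imax[of c] part_antimono[OF a(1), of j c] ji that 3 by (auto simp: le_less)
    have gi: "g i = g j"
      using ji fc[of i] fi part_antimono[OF a(2), of j i] by (cases "i = j") auto
    show ?thesis
    proof (rule ex1I[where a = "Some (f(i := g j - 1), i)"])
      have "f c \<le> g j - 1" if "i < c" for c using after[OF that] by simp
      then have "is_shape (f(i := g j - 1))" using fi by (intro part_decr a) auto
      moreover have "row_step (f(i := g j - 1)) g i = j"
        by (rule row_step_eqI[where g = g, OF gi]) (use lt in \<open>metis less_irrefl\<close>)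
      moreover have "strip (f(i := g j - 1)) g"
        unfolding strip_def
      proof
        fix c
        consider "c = i" | "c \<noteq> i" "c = j" | "c \<noteq> i" "c \<noteq> j" by blast
        then show "(f(i := g j - 1)) c \<le> g c \<and> g c \<le> Suc ((f(i := g j - 1)) c)"
        proof cases
          case 1
          have "g j - 1 \<le> g i" "g i \<le> Suc (g j - 1)" using gi by linarith+
          then show ?thesis using 1 by simp
        next
          case 2
          then show ?thesis using 3(1) by simp
        next
          case 3
          then show ?thesis using fc[OF 3(2)] by simp
        qed
      qed
      ultimately show "?P (Some (f(i := g j - 1), i))"
        using fi 3 by (auto simp: bump_def)
    next
      fix p assume p: "?P p"
      show "p = Some (f(i := g j - 1), i)"
      proof (cases p)
        case None
        then show ?thesis using p 3 row_start_props(1)[OF a(2), where f = f] by auto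
      next
        case (Some q)
        obtain f' i' where q: "q = (f', i')" by (cases q)
        note s = some[of f' i', OF p[unfolded Some q]]
        have "g i' \<le> f i'" using s(2) stripD(2)[OF s(3), of i'] by (simp add: bump_simps)
        then have fi': "f i' = g j" using s part_antimono[OF a(1), of j i'] 3 by simp
        then have "i' \<le> i" by (rule imax)
        have "i' = i"
        proof (rule ccontr)
          assume "i' \<noteq> i"
          then have "f' i = f i" "f i' = Suc (f' i')" using s(2) by (auto simp: bump_simps)
          then show False using part_antimono[OF s(1) \<open>i' \<le> i\<close>] fi fi' by simp
        qed
        then show ?thesis using Some q s fi' by (auto simp: bump_def fun_eq_iff)
      qed
    qed
  qed
qed

lemma col_insertion: "insertion col_start col_step"
proof
  fix f g :: "nat \<Rightarrow> nat"
  assume a: "is_shape f" "is_shape g" "strip f g"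
  let ?j = "col_start f g"
  note p = col_step_props[OF a, of 0, folded col_start_def]
  have "g ?j < g c" if "c < ?j" for c
    using p(2) p(3)[of c] that part_antimono[OF a(1), of c ?j] by simp
  then show "is_shape (bump g ?j) \<and> strip f (bump g ?j)"
    using p(2) a by (auto simp: part_bump_iff strip_def bump_simps intro: le_SucI)
next
  fix f g :: "nat \<Rightarrow> nat" and i
  assume a: "is_shape f" "is_shape (bump f i)" "is_shape g" "strip f g"
  let ?j = "col_step f g i"
  note p = col_step_props[OF a(1,3,4), of i]
  have "g ?j < g c" if "c < ?j" for c
  proof (cases "i \<le> c")
    case True
    then show ?thesis using p(2) p(3)[of c] that part_antimono[OF a(1), of c ?j] by simp
  next
    case False
    then have "f i < f c" using a(1,2) by (simp add: part_bump_iff)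
    then show ?thesis using p(1,2) part_antimono[OF a(1), of i ?j] stripD(1)[OF a(4), of c] by simp
  qed
  then show "is_shape (bump g ?j) \<and> strip (bump f i) (bump g ?j)"
    using p a by (cases "?j = i") (auto simp: part_bump_iff strip_def bump_simps intro: le_SucI)
next
  fix f g :: "nat \<Rightarrow> nat" and j
  assume a: "is_shape f" "is_shape g" "is_shape (bump g j)" "strip f (bump g j)"
  have lt: "g j < g c" if "c < j" for c using a that by (simp add: part_bump_iff)
  have fj: "f j \<le> Suc (g j)" "g j \<le> f j"
    using stripD[OF a(4), of j] by (auto simp: bump_simps)
  have fc: "f c \<le> g c" "g c \<le> Suc (f c)" if "c \<noteq> j" for c
    using stripD[OF a(4), of c] that by (auto simp: bump_simps)
  let ?P = "\<lambda>p. case p of None \<Rightarrow> strip f g \<and> col_start f g = j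
        | Some (f', i) \<Rightarrow> is_shape f' \<and> bump f' i = f \<and> strip f' g \<and> col_step f' g i = j"
  have some: "is_shape f'" "f = bump f' i" "strip f' g" "i \<le> j" "g j = f' j"
    "\<And>c. i \<le> c \<Longrightarrow> c < j \<Longrightarrow> g c = Suc (f' c)" if "?P (Some (f', i))" for f' i
    using that col_step_props[of f' g i] a(2) by auto
  \<comment> \<open>If the new box is not in \<open>f\<close>, it holds the separating letter. In
    the second case all columns left of \<open>j\<close> contain that letter, as they must when it
    is inserted from the left edge; in the third some column does not.\<close>
  consider "f j = Suc (g j)" | "f j = g j" "\<forall>c<j. g c = Suc (f c)" 
    | "f j = g j" "\<exists>c<j. g c = f c" using fj fc by (metis le_Suc_eq le_antisym nat_neq_iff)
  then show "\<exists>!p. ?P p"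
  proof cases
    case 1
    show ?thesis
    proof (rule ex1I[where a = "Some (f(j := g j), j)"])
      have "f c \<le> g j" if "j < c" for c
        using fc[of c] part_antimono[OF a(2), of j c] that by simp
      then have "is_shape (f(j := g j))" using a(1) 1 by (intro part_decr) auto
      moreover have "col_step (f(j := g j)) g j = j" by (intro col_step_eqI) auto
      ultimately show "?P (Some (f(j := g j), j))"
        using 1 fc by (auto simp: bump_def strip_def)
    next
      fix p assume p: "?P p"
      show "p = Some (f(j := g j), j)"
      proof (cases p)
        case None
        then show ?thesis using p stripD(1)[of f g j] 1 by auto
      next
        case (Some q)
        obtain f' i where q: "q = (f', i)" by (cases q)
        note s = some[of f' i, OF p[unfolded Some q]]
        have "i = j" using s(5) 1 s(2) by (auto simp: bump_simps split: if_splits)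
        then show ?thesis using Some q s 1 by (auto simp: bump_def)
      qed
    qed
  next
    case 2
    show ?thesis
    proof (rule ex1I[where a = None])
      have "col_start f g = j" unfolding col_start_def
        using 2 by (intro col_step_eqI) auto
      then show "?P None" using 2 fc by (auto simp: strip_def) (metis le_SucI le_refl)+
    next
      fix p assume p: "?P p"
      show "p = None"
      proof (rule ccontr)
        assume "p \<noteq> None"
        then obtain f' i where pf: "p = Some (f', i)" by auto
        note s = some[of f' i, OF p[unfolded pf]]
        have "i \<noteq> j" using s(2,5) 2 by (auto simp: bump_simps)
        then have "g i = Suc (f i)" "f i = Suc (f' i)" using 2 s by (auto simp: bump_simps)
        then show False using stripD(2)[OF s(3), of i] by simp
      qed
    qed
  next
    case 3
    \<comment> \<open>The nearest column left of \<open>j\<close> without the separating letter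
      after the insertion: the letter was displaced there and moved right past all columns still
      containing it.\<close>
    define i where "i = (GREATEST c. c < j \<and> g c = f c)"
    have i: "i < j \<and> g i = f i" unfolding i_def using 3(2) less_imp_le_nat
      by (intro GreatestI_ex_nat[where P = "\<lambda>c. c < j \<and> g c = f c" and b = j]) auto
    have imax: "c \<le> i" if "c < j" "g c = f c" for c
      unfolding i_def using that
      by (intro Greatest_le_nat[where P = "\<lambda>c. c < j \<and> g c = f c" and b = j]) auto
    have pos: "f i > 0" using i lt[of i] by simp
    have after: "f c \<le> f i - 1" if "i < c" for c
    proof (cases "c < j")
      case True
      then have "g c = Suc (f c)" using imax[of c] fc[of c] that by (auto simp: le_Suc_eq)
      then show ?thesis using part_antimono[OF a(2), of i c] i that by simp
    next
      case False
      then have "f c \<le> f j" using part_antimono[OF a(1)] by simp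
      then show ?thesis using lt[of i] i 3 by simp
    qed
    have bet: "g c \<noteq> (f(i := f i - 1)) c" if "i \<le> c" "c < j" for c
      using imax[of c] i pos that by (cases "c = i") auto
    show ?thesis
    proof (rule ex1I[where a = "Some (f(i := f i - 1), i)"])
      have "is_shape (f(i := f i - 1))" using after by (intro part_decr a) auto
      moreover have "col_step (f(i := f i - 1)) g i = j"
        using i 3 bet by (intro col_step_eqI) auto
      moreover have "strip (f(i := f i - 1)) g"
        unfolding strip_def
      proof
        fix c show "(f(i := f i - 1)) c \<le> g c \<and> g c \<le> Suc ((f(i := f i - 1)) c)"
          using fc[of c] i 3 by (cases "c = i"; cases "c = j") auto
      qed
      ultimately show "?P (Some (f(i := f i - 1), i))"
        using pos by (auto simp: bump_def)
    next
      fix p assume p: "?P p"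
      show "p = Some (f(i := f i - 1), i)"
      proof (cases p)
        case None
        then show ?thesis using p i col_step_props(3)[OF a(1,2), of 0 i] by (auto simp: col_start_def)
      next
        case (Some q)
        obtain f' i' where q: "q = (f', i')" by (cases q)
        note s = some[of f' i', OF p[unfolded Some q]]
        have ij: "i' < j" using s(2,4,5) 3(1) by (cases "i' = j") (auto simp: bump_simps)
        then have "g i' = f i'" using fc(1)[of i'] stripD(2)[OF s(3), of i'] s(2) by (simp add: bump_simps)
        then have "i' \<le> i" using imax ij by blast
        have "i' = i"
        proof (rule ccontr)
          assume "i' \<noteq> i"
          then have "f' i = f i" using s(2) by (auto simp: bump_simps)
          then show False using s(6)[of i] i \<open>i' \<le> i\<close> by simp
        qed
        then show ?thesis using Some q s by (auto simp: bump_def fun_eq_iff)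
      qed
    qed
  qed
qed

text \<open>The shape of the entries below \<open>v\<close>; for \<open>v\<close> beyond the length
  nothing is cut off.\<close>

fun level :: "nat \<Rightarrow> (nat \<Rightarrow> nat) list \<Rightarrow> nat \<Rightarrow> nat" where
  "level v [] = (\<lambda>_. 0)"
| "level v (g # T) = (if v \<le> length T then level v T else g)"

lemma level_drop: "v \<le> length T \<Longrightarrow> level v T = top_shape (drop (length T - v) T)"
  by (induction T) (auto simp: Suc_diff_le le_Suc_eq)

lemma level_top [simp]: "level (length T) T = top_shape T"
  by (cases T) auto

lemma gt_replicate: "gt_pattern (replicate m (\<lambda>_. 0))"
proof (induction m)
  case (Suc m)
  then show ?case by (cases m) (auto simp: part_zero strip_def)
qed auto

lemma level_part: "gt_pattern T \<Longrightarrow> is_shape (level v T)"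
  by (induction T) (auto simp: part_zero)

definition chain :: "(nat \<Rightarrow> nat \<Rightarrow> bool) \<Rightarrow> nat \<Rightarrow> (nat \<Rightarrow> bool) \<Rightarrow> nat list \<Rightarrow> bool" where
  "chain R t P u \<longleftrightarrow> (\<exists>s. subseq s u \<and> sorted_wrt R s \<and> length s = t \<and> (\<forall>x\<in>set s. P x))"

lemma chain_0 [simp]: "chain R 0 P u"
  by (simp add: chain_def)

lemma chain_Nil [simp]: "chain R t P [] \<longleftrightarrow> t = 0"
  by (auto simp: chain_def)

text \<open>Absorbing \<open>R x\<close> into the predicate makes chains recursive in the prepended
  letter, the form in which they are compared with insertion.\<close>

lemma chain_Cons:
  assumes "t > 0"
  shows "chain R t P (x # u) \<longleftrightarrow> chain R t P u \<or> (P x \<and> chain R (t - 1) (\<lambda>y. P y \<and> R x y) u)"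
proof
  assume "chain R t P (x # u)"
  then obtain s where s: "subseq s (x # u)" "sorted_wrt R s" "length s = t" "\<forall>x\<in>set s. P x"
    by (auto simp: chain_def)
  show "chain R t P u \<or> (P x \<and> chain R (t - 1) (\<lambda>y. P y \<and> R x y) u)"
  proof (cases "subseq s u")
    case True
    then show ?thesis using s by (auto simp: chain_def)
  next
    case False
    obtain y s' where ys: "s = y # s'" using s assms by (cases s) auto
    then have "y = x" "subseq s' u" using s(1) False
      by (auto simp: subseq_Cons2_iff split: if_splits dest: subseq_Cons')
    then show ?thesis using s ys unfolding chain_def
      by (intro disjI2 conjI exI[of _ s']) auto
  qed
next
  assume "chain R t P u \<or> (P x \<and> chain R (t - 1) (\<lambda>y. P y \<and> R x y) u)"
  then show "chain R t P (x # u)"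
  proof
    assume "chain R t P u"
    then obtain s where "subseq s u" "sorted_wrt R s" "length s = t" "\<forall>x\<in>set s. P x"
      by (auto simp: chain_def)
    then show ?thesis unfolding chain_def by (intro exI[of _ s]) auto
  next
    assume "P x \<and> chain R (t - 1) (\<lambda>y. P y \<and> R x y) u"
    then obtain s where "P x" "subseq s u" "sorted_wrt R s" "length s = t - 1"
       "\<forall>y\<in>set s. P y \<and> R x y"
      by (auto simp: chain_def)
    then show ?thesis unfolding chain_def using assms
      by (intro exI[of _ "x # s"]) auto
  qed
qed

context insertion
begin

definition tableau :: "nat \<Rightarrow> nat list \<Rightarrow> (nat \<Rightarrow> nat) list" where
  "tableau m u = foldr (\<lambda>x T. if x < m then insert_letter x T else T) u (replicate m (\<lambda>_. 0))"

lemma tab_Nil [simp]: "tableau m [] = replicate m (\<lambda>_. 0)"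
  by (simp add: tableau_def)

lemma tab_Cons [simp]: "tableau m (x # u) = (if x < m then insert_letter x (tableau m u) else tableau m u)"
  by (simp add: tableau_def)

lemma length_tab [simp]: "length (tableau m u) = m"
  by (induction u) auto

lemma gt_tab: "gt_pattern (tableau m u)"
  by (induction u) (auto simp: gt_ins gt_replicate)

lemma drop_ins: "x < length T \<Longrightarrow> drop k (insert_letter x T) = (if x < length T - k then insert_letter x (drop k T) else drop k T)"
proof (induction T arbitrary: k)
  case (Cons g T)
  then show ?case by (cases k) (auto simp: less_diff_conv)
qed auto

text \<open>A level is affected only by letters below its bound, so cutting off levels amounts to
  ignoring large letters from the start.\<close>

lemma drop_tab: "v \<le> m \<Longrightarrow> drop (m - v) (tableau m u) = tableau v u"
  by (induction u) (auto simp: drop_ins)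

lemma level_tab: "v \<le> m \<Longrightarrow> level v (tableau m u) = top_shape (tableau v u)"
  by (simp add: level_drop drop_tab)

text \<open>An insertion must produce a shape again; this restricts the column that can be
  hit.\<close>

lemma top_ins_part: "gt_pattern T \<Longrightarrow> T \<noteq> [] \<Longrightarrow> is_shape (bump (top_shape T) (carry x T))"
  using gt_part[OF gt_ins[of T x]] top_ins[of T x] by simp

lemma top_tab_ge_length: "length u \<le> c \<Longrightarrow> top_shape (tableau m u) c = 0"
proof (induction u arbitrary: c)
  case Nil
  then show ?case by (cases m) auto
next
  case (Cons x u)
  then obtain d where c: "c = Suc d" "length u \<le> d" by (cases c) auto
  show ?case
  proof (cases "x < m")
    case True
    then have ne: "tableau m u \<noteq> []" by (metis length_tab length_0_conv less_zeroE)
    have z: "top_shape (tableau m u) d = 0" "top_shape (tableau m u) c = 0" using Cons.IH c by auto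
    have "\<forall>c'<carry x (tableau m u). top_shape (tableau m u) (carry x (tableau m u)) < top_shape (tableau m u) c'"
      using top_ins_part[OF gt_tab ne, of x] by (simp add: part_bump_iff gt_part gt_tab)
    then have "c \<noteq> carry x (tableau m u)" using z(1) c(1) by (metis lessI less_zeroE)
    then show ?thesis using True z top_ins[OF ne] by (simp add: bump_simps)
  next
    case False
    then show ?thesis using Cons.IH[of c] c by simp
  qed
qed

end

section \<open>Row insertion and weakly decreasing chains\<close>

interpretation row: insertion row_start row_step by (rule row_insertion)
interpretation col: insertion col_start col_step by (rule col_insertion)

text \<open>In the first row \<open>x\<close> lands right behind the entries at most
  \<open>x\<close>, which are the first row of \<open>level (Suc x)\<close>. So the row reaches
  column \<open>c\<close> if it did before or if those entries reach column
  \<open>c - 1\<close>.\<close>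

lemma row_ins_nonzero:
  assumes "gt_pattern T" "x < length T"
  shows "top_shape (row.insert_letter x T) c \<noteq> 0 \<longleftrightarrow> top_shape T c \<noteq> 0 \<or> c = 0 \<or> level (Suc x) T (c - 1) \<noteq> 0"
  using assms
proof (induction T)
  case (Cons g T)
  have g: "is_shape g" "strip (top_shape T) g" "gt_pattern T" using Cons.prems by auto
  show ?case
  proof (cases "x < length T")
    case True
    let ?f = "top_shape T" and ?i = "row.carry x T"
    have "T \<noteq> []" using True by auto
    have IH: "bump ?f ?i c \<noteq> 0 \<longleftrightarrow> ?f c \<noteq> 0 \<or> c = 0 \<or> level (Suc x) T (c - 1) \<noteq> 0"
      using Cons.IH g True row.top_ins[OF \<open>T \<noteq> []\<close>, of x] by simp
    \<comment> \<open>If \<open>g\<close> is empty in column \<open>?i\<close>, this is its first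
      empty column, since \<open>f\<close> is nonempty everywhere to the left. The first row of
      \<open>g\<close> thus grows only where that of \<open>f\<close> does.\<close>
    have *: "row_step ?f g ?i = ?i" if "g ?i = 0"
    proof (rule row_step_eqI[OF refl])
      fix d assume "d < ?i"
      then have "?f ?i < ?f d"
        using row.top_ins_part[OF g(3) \<open>T \<noteq> []\<close>, of x] by (simp add: part_bump_iff gt_part g)
      then show "g d \<noteq> g ?i" using that stripD(1)[OF g(2), of d] by simp
    qed
    have **: "g (row_step ?f g ?i) = g ?i" using row_step_props(2)[OF g(1)] .
    have fg: "?f c \<noteq> 0 \<Longrightarrow> g c \<noteq> 0" using stripD(1)[OF g(2), of c] by simp
    have "top_shape (row.insert_letter x (g # T)) c \<noteq> 0 \<longleftrightarrow> g c \<noteq> 0 \<or> c = row_step ?f g ?i"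
      using True by (auto simp: bump_simps)
    also have "\<dots> \<longleftrightarrow> g c \<noteq> 0 \<or> c = ?i"
      using * ** by (cases "g ?i = 0") auto
    also have "\<dots> \<longleftrightarrow> g c \<noteq> 0 \<or> bump ?f ?i c \<noteq> 0"
      using fg by (auto simp: bump_simps)
    also have "\<dots> \<longleftrightarrow> g c \<noteq> 0 \<or> c = 0 \<or> level (Suc x) T (c - 1) \<noteq> 0"
      using IH fg by auto
    finally show ?thesis using True by simp
  next
    case False
    let ?n = "row_start (top_shape T) g"
    note n = row_start_props[OF g(1), where f = "top_shape T"]
    have "c = ?n" if "g c = 0" "c = 0 \<or> g (c - 1) \<noteq> 0"
    proof (rule antisym)
      show "?n \<le> c" using n(2)[of c] that by (auto simp: not_less[symmetric])
      show "c \<le> ?n"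
      proof (rule ccontr)
        assume "\<not> c \<le> ?n"
        then have "g (c - 1) \<le> g ?n" by (intro part_antimono[OF g(1)]) simp
        then show False using n(1) that \<open>\<not> c \<le> ?n\<close> by simp
      qed
    qed
    moreover have "c = 0 \<or> g (c - 1) \<noteq> 0" if "c = ?n" using n(2)[of "c - 1"] that by (cases c) auto
    moreover have "top_shape (row.insert_letter x (g # T)) c \<noteq> 0 \<longleftrightarrow> g c \<noteq> 0 \<or> c = ?n"
      using False by (auto simp: bump_simps)
    ultimately show ?thesis using False by auto
  qed
qed auto

text \<open>Schensted's theorem: \<open>chain_Cons\<close> and \<open>row_ins_nonzero\<close> are
  the same recursion. A chain through \<open>x\<close> continues below \<open>Suc x\<close>, hence
  the induction over all bounds \<open>m\<close>.\<close>

lemma row_chain: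
  assumes "t > 0"
  shows "chain (\<ge>) t (\<lambda>y. y < m) u \<longleftrightarrow> top_shape (row.tableau m u) (t - 1) \<noteq> 0"
  using assms
proof (induction u arbitrary: t m)
  case Nil
  then show ?case by (cases m) auto
next
  case (Cons x u)
  show ?case
  proof (cases "x < m")
    case True
    have "(\<lambda>y. y < m \<and> y \<le> x) = (\<lambda>y. y < Suc x)" using True by auto
    then have "chain (\<ge>) t (\<lambda>y. y < m) (x # u) \<longleftrightarrow>
      chain (\<ge>) t (\<lambda>y. y < m) u \<or> chain (\<ge>) (t - 1) (\<lambda>y. y < Suc x) u"
      using True chain_Cons[OF Cons.prems, of "(\<ge>)" "\<lambda>y. y < m" x u] by simp
    also have "\<dots> \<longleftrightarrow> top_shape (row.tableau m u) (t - 1) \<noteq> 0 \<or> t - 1 = 0 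
        \<or> top_shape (row.tableau (Suc x) u) (t - 1 - 1) \<noteq> 0"
      using Cons.IH[of t m] Cons.IH[of "t - 1" "Suc x"] Cons.prems by (cases "t - 1 = 0") auto
    also have "\<dots> \<longleftrightarrow> top_shape (row.insert_letter x (row.tableau m u)) (t - 1) \<noteq> 0"
      using row_ins_nonzero[OF row.gt_tab, of x m u "t - 1"] True by (simp add: row.level_tab)
    finally show ?thesis using True by simp
  next
    case False
    then show ?thesis using Cons by (simp add: chain_Cons)
  qed
qed

section \<open>Column insertion, column by column, and weakly increasing chains\<close>

fun first_col :: "(nat \<Rightarrow> nat) list \<Rightarrow> nat set" where
  "first_col [] = {}"
| "first_col (g # T) = first_col T \<union> (if g 0 \<noteq> top_shape T 0 then {length T} else {})"

text \<open>Mapped over a tableau it removes the first column, whose letters are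
  \<open>first_col\<close>; the level-wise insertion can then be analysed one column at a
  time.\<close>

definition shift :: "(nat \<Rightarrow> nat) \<Rightarrow> nat \<Rightarrow> nat" where
  "shift g c = g (Suc c)"

lemma first_col_less: "y \<in> first_col T \<Longrightarrow> y < length T"
  by (induction T) (auto split: if_splits)

lemma top_shift: "top_shape (map shift T) = shift (top_shape T)"
  by (cases T) (auto simp: shift_def)

lemma part_shift: "is_shape g \<Longrightarrow> is_shape (shift g)"
proof -
  assume g: "is_shape g"
  then obtain c where "g c = 0" by (auto simp: is_shape_def)
  then have "shift g c = 0" using part_antimono[OF g, of c "Suc c"] by (simp add: shift_def)
  then show ?thesis using part_antimono[OF g] unfolding is_shape_def antimono_def shift_def by auto
qed

lemma strip_shift: "strip f g \<Longrightarrow> strip (shift f) (shift g)"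
  by (simp add: strip_def shift_def)

lemma gt_shift: "gt_pattern T \<Longrightarrow> gt_pattern (map shift T)"
  by (induction T) (auto simp: part_shift strip_shift top_shift)

lemma level_shift: "level v (map shift T) = shift (level v T)"
  by (induction T) (auto simp: shift_def)

lemma shift_bump_0: "shift (bump g 0) = shift g"
  by (auto simp: shift_def bump_simps)

lemma shift_bump_Suc: "shift (bump g (Suc c)) = bump (shift g) c"
  by (auto simp: shift_def bump_simps)

lemma col_step_Suc:
  assumes "is_shape f" "is_shape g" "strip f g"
  shows "col_step f g (Suc i) = Suc (col_step (shift f) (shift g) i)"
proof -
  note p = col_step_props[OF part_shift[OF assms(1)] part_shift[OF assms(2)] strip_shift[OF assms(3)], of i]
  show ?thesis
  proof (rule col_step_eqI)
    fix c assume c: "Suc i \<le> c" "c < Suc (col_step (shift f) (shift g) i)"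
    then show "g c \<noteq> f c" using p(3)[of "c - 1"] by (cases c) (auto simp: shift_def)
  qed (use p(1,2) in \<open>auto simp: shift_def\<close>)
qed

lemma col_step_0:
  assumes "is_shape f" "is_shape g" "strip f g"
  shows "col_step f g 0 = (if g 0 = f 0 then 0 else Suc (col_step (shift f) (shift g) 0))"
proof (cases "g 0 = f 0")
  case True
  then show ?thesis by (simp add: col_step_eqI)
next
  case False
  then have "col_step f g 0 \<noteq> 0" using col_step_props(2)[OF assms, of 0] by metis
  then have "col_step f g 0 = col_step f g (Suc 0)"
    using col_step_props[OF assms, of 0]
    by (intro col_step_eqI[symmetric]) auto
  then show ?thesis using False col_step_Suc[OF assms] by simp
qed

lemma col_carry_0:
  assumes "gt_pattern T" "x < length T" "\<forall>y\<in>first_col T. y < x"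
  shows "col.carry x T = 0"
  using assms
proof (induction T)
  case (Cons g T)
  have "g 0 = top_shape T 0" using Cons.prems by (auto split: if_splits)
  then have *: "col_step (top_shape T) g 0 = 0" by (simp add: col_step_eqI)
  show ?case
  proof (cases "x < length T")
    case True
    then show ?thesis using Cons * by simp
  next
    case False
    then show ?thesis using * col_start_def[of "top_shape T" g] by simp
  qed
qed auto

lemma col_carry_Suc:
  assumes "gt_pattern T" "x < length T" "y \<in> first_col T" "x \<le> y" "\<forall>z\<in>first_col T. x \<le> z \<longrightarrow> y \<le> z"
  shows "col.carry x T = Suc (col.carry y (map shift T))"
  using assms
proof (induction T)
  case (Cons g T)
  have g: "is_shape (top_shape T)" "is_shape g" "strip (top_shape T) g" "gt_pattern T" using Cons.prems gt_part by auto
  have y: "y \<le> length T" using first_col_less[OF Cons.prems(3)] by simp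
  show ?case
  proof (cases "y < length T")
    case True
    then have "y \<in> first_col T" using Cons.prems by (auto split: if_splits)
    then have "col.carry x T = Suc (col.carry y (map shift T))"
      using Cons True g by auto
    then show ?thesis using True Cons.prems col_step_Suc[OF g(1-3)] by (simp add: top_shift)
  next
    case False
    then have yl: "y = length T" using y by simp
    have "y \<notin> first_col T" using first_col_less yl by blast
    then have ne: "g 0 \<noteq> top_shape T 0" using Cons.prems(3) by (auto split: if_splits)
    \<comment> \<open>As \<open>y\<close> is both the largest possible letter and the least one
      \<open>\<ge> x\<close> in the first column, the smaller levels contain only letters below
      \<open>x\<close> there.\<close>
    have "col.carry x T = 0" if "x < length T"
    proof (rule col_carry_0[OF g(4) that], rule ballI, rule ccontr)
      fix z assume z: "z \<in> first_col T" "\<not> z < x"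
      then have "y \<le> z" using Cons.prems(5) by auto
      then show False using first_col_less[OF z(1)] yl by simp
    qed
    then show ?thesis using yl ne col_step_0[OF g(1-3)] col_start_def[of "top_shape T" g]
        col_start_def[of "shift (top_shape T)" "shift g"] by (auto simp: top_shift)
  qed
qed auto

lemma col_ins_no:
  assumes "gt_pattern T" "x < length T" "\<forall>y\<in>first_col T. y < x"
  shows "map shift (col.insert_letter x T) = map shift T \<and> first_col (col.insert_letter x T) = insert x (first_col T)"
  using assms
proof (induction T)
  case (Cons g T)
  have c: "col.carry x (g # T) = 0" using col_carry_0[OF Cons.prems] .
  have g: "g 0 = top_shape T 0" using Cons.prems by (auto split: if_splits)
  show ?case
  proof (cases "x < length T")
    case True
    then have "T \<noteq> []" by auto
    have "col.carry x T = 0" using Cons.prems True by (intro col_carry_0) auto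
    then have "top_shape (col.insert_letter x T) 0 = Suc (top_shape T 0)"
      using col.top_ins[OF \<open>T \<noteq> []\<close>, of x] by (simp add: bump_simps)
    then show ?thesis using c g True Cons by (simp add: shift_bump_0 bump_simps)
  next
    case False
    then have "x = length T" using Cons.prems by simp
    then show ?thesis using c g by (simp add: shift_bump_0 bump_simps)
  qed
qed auto

text \<open>With \<open>col_ins_no\<close> this recovers the classical description: \<open>x\<close>
  replaces the least \<open>y \<ge> x\<close> in the first column, and \<open>y\<close> is inserted
  into the remaining columns.\<close>

lemma col_ins_bump:
  assumes "gt_pattern T" "x < length T" "y \<in> first_col T" "x \<le> y" "\<forall>z\<in>first_col T. x \<le> z \<longrightarrow> y \<le> z"
  shows "map shift (col.insert_letter x T) = col.insert_letter y (map shift T) \<and>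
    first_col (col.insert_letter x T) = insert x (first_col T - {y})"
  using assms
proof (induction T)
  case (Cons g T)
  note c = col_carry_Suc[OF Cons.prems]
  have g: "is_shape (top_shape T)" "is_shape g" "strip (top_shape T) g" "gt_pattern T" using Cons.prems gt_part by auto
  have y: "y \<le> length T" using first_col_less[OF Cons.prems(3)] by simp
  have c0: "bump g (col.carry x (g # T)) 0 = g 0" using c by (simp add: bump_simps)
  have cs: "shift (bump g (col.carry x (g # T))) = bump (shift g) (col.carry y (map shift (g # T)))"
    using c by (simp only: shift_bump_Suc)
  have lT: "length T \<notin> first_col T" using first_col_less by blast
  show ?case
  proof (cases "y < length T")
    case True
    then have x: "x < length T" "T \<noteq> []" using Cons.prems by auto
    have yT: "y \<in> first_col T" using True Cons.prems by (auto split: if_splits)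
    have IH: "map shift (col.insert_letter x T) = col.insert_letter y (map shift T) \<and>
      first_col (col.insert_letter x T) = insert x (first_col T - {y})"
      using Cons.IH Cons.prems yT x g by auto
    have "col.carry x T = Suc (col.carry y (map shift T))"
      using Cons.prems yT x g by (intro col_carry_Suc) auto
    then have t0: "top_shape (col.insert_letter x T) 0 = top_shape T 0"
      using col.top_ins[OF x(2), of x] by (simp add: bump_simps)
    have "first_col (col.insert_letter x (g # T)) = 
       first_col (col.insert_letter x T) \<union> (if g 0 \<noteq> top_shape T 0 then {length T} else {})"
      using c0 t0 x by simp
    then have "first_col (col.insert_letter x (g # T)) = insert x (first_col (g # T) - {y})"
      using IH True by auto
    moreover have "map shift (col.insert_letter x (g # T)) = col.insert_letter y (map shift (g # T))"
      using cs IH x True by simp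
    ultimately show ?thesis by simp
  next
    case False
    then have yl: "y = length T" using y by simp
    have ne: "g 0 \<noteq> top_shape T 0" using Cons.prems(3) lT yl by (auto split: if_splits)
    have g0: "g 0 = Suc (top_shape T 0)" using ne stripD[OF g(3), of 0] by simp
    show ?thesis
    proof (cases "x < length T")
      case True
      then have "T \<noteq> []" by auto
      have no: "\<forall>z\<in>first_col T. z < x"
      proof (rule ballI, rule ccontr)
        fix z assume z: "z \<in> first_col T" "\<not> z < x"
        then have "y \<le> z" using Cons.prems(5) by auto
        then show False using first_col_less[OF z(1)] yl by simp
      qed
      note no' = col_ins_no[OF g(4) True no]
      have "top_shape (col.insert_letter x T) 0 = Suc (top_shape T 0)"
        using col.top_ins[OF \<open>T \<noteq> []\<close>, of x] col_carry_0[OF g(4) True no] by (simp add: bump_simps)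
      then have "first_col (col.insert_letter x (g # T)) = insert x (first_col T)"
        using c0 g0 no' True by simp
      then have "first_col (col.insert_letter x (g # T)) = insert x (first_col (g # T) - {y})"
        using yl lT by auto
      moreover have "map shift (col.insert_letter x (g # T)) = col.insert_letter y (map shift (g # T))"
        using cs no' True yl by simp
      ultimately show ?thesis by simp
    next
      case False
      then have "x = length T" using Cons.prems by simp
      then have "first_col (col.insert_letter x (g # T)) = insert x (first_col (g # T) - {y})"
        using yl lT c0 ne by auto
      moreover have "map shift (col.insert_letter x (g # T)) = col.insert_letter y (map shift (g # T))"
        using cs False yl by simp
      ultimately show ?thesis by simp
    qed
  qed
qed auto

text \<open>\<open>selectable N T a t\<close> says that \<open>t\<close> weakly increasing letters \<open>\<ge> a\<close> can be chosen from distinct columns of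
  \<open>T\<close>, from left to right among the first \<open>N\<close>. Under column insertion it satisfies the same recursion
  as the existence of weakly increasing chains when a letter is prepended to a word, which
  the length of the first row alone does not.\<close>

fun selectable :: "nat \<Rightarrow> (nat \<Rightarrow> nat) list \<Rightarrow> nat \<Rightarrow> nat \<Rightarrow> bool" where
  "selectable 0 T a t \<longleftrightarrow> t = 0"
| "selectable (Suc N) T a t \<longleftrightarrow> selectable N (map shift T) a t \<or>
     (t > 0 \<and> (\<exists>y\<in>first_col T. a \<le> y \<and> selectable N (map shift T) y (t - 1)))"

lemma sel_antimono: "a \<le> b \<Longrightarrow> selectable N T b t \<Longrightarrow> selectable N T a t"
  by (induction N arbitrary: T) (auto intro: order_trans)

lemma first_col_top: "gt_pattern T \<Longrightarrow> y \<in> first_col T \<Longrightarrow> top_shape T 0 \<noteq> 0"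
proof (induction T)
  case (Cons g T)
  then show ?case using stripD(1)[of "top_shape T" g 0] by (auto split: if_splits)
qed auto

text \<open>Mirrors \<open>chain_Cons\<close>. If \<open>x\<close> displaces \<open>y\<close>, then
  picking \<open>y\<close> from a later column now replaces picking it from the first column before,
  and picking \<open>x\<close> and then \<open>y\<close> is the recursive case. \<open>Suc N\<close>
  leaves room for a new column.\<close>

lemma sel_ins:
  assumes "gt_pattern T" "x < length T" "top_shape T N = 0"
  shows "selectable (Suc N) (col.insert_letter x T) a t \<longleftrightarrow>
    selectable (Suc N) T a t \<or> (a \<le> x \<and> t > 0 \<and> selectable (Suc N) T x (t - 1))"
  using assms
proof (induction N arbitrary: T x a t)
  case 0
  then have "first_col T = {}" using first_col_top by blast
  moreover from this have "first_col (col.insert_letter x T) = {x}" using col_ins_no 0 by auto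
  ultimately show ?case by auto
next
  case (Suc N)
  define Q where "Q = selectable (Suc N) (map shift T)"
  have S: "selectable (Suc (Suc N)) T a t \<longleftrightarrow> Q a t \<or> (t > 0 \<and> (\<exists>y\<in>first_col T. a \<le> y \<and> Q y (t - 1)))" for a t
    unfolding Q_def by simp
  have Qm: "Q b t \<Longrightarrow> a \<le> b \<Longrightarrow> Q a t" for a b t unfolding Q_def by (rule sel_antimono)
  show ?case
  proof (cases "\<forall>y\<in>first_col T. y < x")
    case True
    note n = col_ins_no[OF Suc.prems(1,2) True]
    have S': "selectable (Suc (Suc N)) (col.insert_letter x T) a t \<longleftrightarrow>
        Q a t \<or> (t > 0 \<and> (\<exists>y\<in>insert x (first_col T). a \<le> y \<and> Q y (t - 1)))"
      using n unfolding Q_def by simp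
    show ?thesis unfolding S S' using True by auto
  next
    case False
    define y where "y = (LEAST y. y \<in> first_col T \<and> x \<le> y)"
    have "\<exists>y. y \<in> first_col T \<and> x \<le> y" using False by auto
    then have y: "y \<in> first_col T" "x \<le> y"
      unfolding y_def by (metis (mono_tags, lifting) LeastI)+
    have ymin: "\<forall>z\<in>first_col T. x \<le> z \<longrightarrow> y \<le> z" unfolding y_def by (auto intro: Least_le)
    note n = col_ins_bump[OF Suc.prems(1,2) y ymin]
    have IH: "selectable (Suc N) (col.insert_letter y (map shift T)) b s \<longleftrightarrow> Q b s \<or> (b \<le> y \<and> s > 0 \<and> Q y (s - 1))" for b s
      unfolding Q_def using Suc.prems first_col_less[OF y(1)]
      by (intro Suc.IH gt_shift) (auto simp: top_shift shift_def)
    define F where "F = first_col T"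
    have S': "selectable (Suc (Suc N)) (col.insert_letter x T) a t \<longleftrightarrow>
        (Q a t \<or> (a \<le> y \<and> t > 0 \<and> Q y (t - 1))) \<or> 
        (t > 0 \<and> (\<exists>z\<in>insert x (F - {y}). a \<le> z \<and> (Q z (t - 1) \<or> (z \<le> y \<and> t - 1 > 0 \<and> Q y (t - 1 - 1)))))"
      by (simp only: selectable.simps(2)[of "Suc N"] n[THEN conjunct1] n[THEN conjunct2] IH F_def)
    have S2: "selectable (Suc (Suc N)) T a t \<longleftrightarrow> Q a t \<or> (t > 0 \<and> (\<exists>y\<in>F. a \<le> y \<and> Q y (t - 1)))" for a t
      using S F_def by simp
    have yF: "y \<in> F" "\<And>z. z \<in> F \<Longrightarrow> x \<le> z \<Longrightarrow> y \<le> z" using y ymin F_def by auto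
    show ?thesis
    proof
      assume "selectable (Suc (Suc N)) (col.insert_letter x T) a t"
      then consider "Q a t" | "a \<le> y" "t > 0" "Q y (t - 1)" 
        | z where "t > 0" "z \<in> insert x (F - {y})" "a \<le> z" "Q z (t - 1)"
        | z where "t > 0" "z \<in> insert x (F - {y})" "a \<le> z" "z \<le> y" "t - 1 > 0" "Q y (t - 1 - 1)"
        unfolding S' by blast
      then show "selectable (Suc (Suc N)) T a t \<or> (a \<le> x \<and> t > 0 \<and> selectable (Suc (Suc N)) T x (t - 1))"
      proof cases
        case (4 z)
        \<comment> \<open>No letter of the old first column lies strictly between \<open>x\<close>
          and \<open>y\<close>.\<close>
        have "z \<le> x" using 4 yF(2)[of z] by fastforce
        then have "a \<le> x" using 4 by simp
        then show ?thesis unfolding S2 using 4 yF(1) y(2) by blast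
      next
        case 1
        then show ?thesis unfolding S2 by blast
      next
        case 2
        then show ?thesis unfolding S2 using yF(1) by blast
      next
        case (3 z)
        then show ?thesis unfolding S2 by blast
      qed
    next
      assume "selectable (Suc (Suc N)) T a t \<or> (a \<le> x \<and> t > 0 \<and> selectable (Suc (Suc N)) T x (t - 1))"
      then consider "Q a t" | z where "t > 0" "z \<in> F" "a \<le> z" "Q z (t - 1)"
        | "a \<le> x" "t > 0" "Q x (t - 1)"
        | z where "a \<le> x" "t > 0" "t - 1 > 0" "z \<in> F" "x \<le> z" "Q z (t - 1 - 1)"
        unfolding S2 by blast
      then show "selectable (Suc (Suc N)) (col.insert_letter x T) a t"
      proof cases
        case (2 z)
        then show ?thesis unfolding S' by (cases "z = y") auto
      next
        case (4 z)
        then have "Q y (t - 1 - 1)" using yF(2) Qm by blast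
        then show ?thesis unfolding S' using 4 y(2) by blast
      next
        case 1
        then show ?thesis unfolding S' by blast
      next
        case 3
        then show ?thesis unfolding S' by blast
      qed
    qed
  qed
qed

lemma sel_Nil: "selectable N (replicate m (\<lambda>_. 0)) a t \<longleftrightarrow> t = 0"
proof (induction N arbitrary: a t)
  case (Suc N)
  have "map shift (replicate m (\<lambda>_. 0)) = replicate m (\<lambda>_. 0)"
    by (simp add: shift_def fun_eq_iff)
  moreover have "first_col (replicate m (\<lambda>_. 0)) = {}"
  proof (induction m)
    case (Suc m)
    then show ?case by (cases m) auto
  qed auto
  ultimately show ?case using Suc by (simp only: selectable.simps) simp
qed auto

lemma chain_sel:
  assumes "length u \<le> N"
  shows "chain (\<le>) t (\<lambda>y. a \<le> y \<and> y < m) u \<longleftrightarrow> selectable (Suc N) (col.tableau m u) a t"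
  using assms
proof (induction u arbitrary: t a)
  case Nil
  then show ?case by (simp only: sel_Nil col.tab_Nil chain_Nil)
next
  case (Cons x u)
  show ?case
  proof (cases "t = 0")
    case True
    have "selectable N T a 0" for N T a by (induction N arbitrary: T) auto
    then show ?thesis using True by simp
  next
    case False
    show ?thesis
    proof (cases "x < m")
      case True
      have "(\<lambda>y. (a \<le> y \<and> y < m) \<and> x \<le> y) = (\<lambda>y. x \<le> y \<and> y < m)" if "a \<le> x" using that by auto
      then have "chain (\<le>) t (\<lambda>y. a \<le> y \<and> y < m) (x # u) \<longleftrightarrow>
        chain (\<le>) t (\<lambda>y. a \<le> y \<and> y < m) u \<or> (a \<le> x \<and> chain (\<le>) (t - 1) (\<lambda>y. x \<le> y \<and> y < m) u)"
        using True False chain_Cons[of t "(\<le>)" "\<lambda>y. a \<le> y \<and> y < m" x u] by auto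
      also have "\<dots> \<longleftrightarrow> selectable (Suc N) (col.tableau m u) a t \<or> (a \<le> x \<and> t > 0 \<and> selectable (Suc N) (col.tableau m u) x (t - 1))"
        using Cons False by simp
      also have "\<dots> \<longleftrightarrow> selectable (Suc N) (col.insert_letter x (col.tableau m u)) a t"
        using True Cons.prems by (intro sel_ins[symmetric] col.gt_tab col.top_tab_ge_length) auto
      finally show ?thesis using True by simp
    next
      case False
      then show ?thesis using Cons \<open>t \<noteq> 0\<close> by (simp add: chain_Cons)
    qed
  qed
qed

lemma first_col_after:
  assumes "gt_pattern T" "level a T 0 = 0" "top_shape T 0 \<noteq> 0"
  shows "\<exists>y\<in>first_col T. a \<le> y \<and> level y T 0 = 0"
  using assms
proof (induction T)
  case (Cons g T)
  have a: "a \<le> length T" using Cons.prems by (auto split: if_splits)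
  show ?case
  proof (cases "top_shape T 0 = 0")
    case True
    then show ?thesis using Cons.prems a by (intro bexI[of _ "length T"]) auto
  next
    case False
    then obtain y where y: "y \<in> first_col T" "a \<le> y" "level y T 0 = 0" using Cons a by auto
    then show ?thesis using first_col_less[OF y(1)] by (intro bexI[of _ y]) auto
  qed
qed auto

text \<open>No entry is below \<open>a\<close>, so an initial part of the first row, being weakly
  increasing, is a selection; a longer one is impossible because the columns are distinct.\<close>

lemma sel_iff:
  assumes "gt_pattern T" "top_shape T N = 0" "level a T 0 = 0"
  shows "selectable N T a t \<longleftrightarrow> t = 0 \<or> top_shape T (t - 1) \<noteq> 0"
  using assms
proof (induction N arbitrary: T a t)
  case 0
  then show ?case using part_antimono[OF gt_part, of T 0] by force
next
  case (Suc N)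
  have sh: "gt_pattern (map shift T)" "top_shape (map shift T) N = 0"
    using Suc.prems by (auto simp: gt_shift top_shift shift_def)
  have shl: "level b (map shift T) 0 = 0" if "level b T 0 = 0" for b
    using part_antimono[OF level_part[OF Suc.prems(1), of b], of 0 1] that
    by (simp add: level_shift shift_def)
  have mono: "top_shape T c \<noteq> 0" if "top_shape T (Suc c) \<noteq> 0" for c
    using part_antimono[OF gt_part[OF Suc.prems(1)], of c "Suc c"] that by simp
  have IH: "selectable N (map shift T) b s \<longleftrightarrow> s = 0 \<or> top_shape T s \<noteq> 0" if "level b T 0 = 0" for b s
    using Suc.IH[OF sh shl[OF that], of s] by (cases s) (auto simp: top_shift shift_def)
  show ?case
  proof
    assume "selectable (Suc N) T a t"
    then consider "selectable N (map shift T) a t" | y where "t > 0" "y \<in> first_col T" "selectable N (map shift T) y (t - 1)"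
      by auto
    then show "t = 0 \<or> top_shape T (t - 1) \<noteq> 0"
    proof cases
      case 1
      then show ?thesis using IH[OF Suc.prems(3)] mono[of "t - 1"] by (cases t) auto
    next
      case 2
      \<comment> \<open>Entries smaller than \<open>y\<close> may exist, so the bound is weakened to
        0, where the induction hypothesis applies.\<close>
      have "selectable N (map shift T) 0 (t - 1)" using sel_antimono[OF _ 2(3), of 0] by simp
      moreover have "level 0 T 0 = 0" by (induction T) auto
      ultimately have "t - 1 = 0 \<or> top_shape T (t - 1) \<noteq> 0" using IH by blast
      then show ?thesis using first_col_top[OF Suc.prems(1) 2(2)] by auto
    qed
  next
    assume t: "t = 0 \<or> top_shape T (t - 1) \<noteq> 0"
    show "selectable (Suc N) T a t"
    proof (cases "t = 0")
      case True
      then show ?thesis using IH[OF Suc.prems(3)] by simp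
    next
      case False
      then have "top_shape T 0 \<noteq> 0"
        using t part_antimono[OF gt_part[OF Suc.prems(1)], of 0 "t - 1"] by simp
      then obtain y where y: "y \<in> first_col T" "a \<le> y" "level y T 0 = 0"
        using first_col_after Suc.prems by blast
      have "selectable N (map shift T) y (t - 1)" using IH[OF y(3)] t False by auto
      then show ?thesis using y False by auto
    qed
  qed
qed

lemma col_chain:
  assumes "t > 0"
  shows "chain (\<le>) t (\<lambda>y. y < m) u \<longleftrightarrow> top_shape (col.tableau m u) (t - 1) \<noteq> 0"
proof -
  have "level 0 (col.tableau m u) 0 = 0"
    using col.length_tab[of 0 u] by (simp add: col.level_tab del: col.length_tab)
  then show ?thesis
    using chain_sel[of u "length u" t 0 m] assms
      sel_iff[OF col.gt_tab, of m u "Suc (length u)" 0 t] col.top_tab_ge_length[of u "Suc (length u)" m]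
    by simp
qed

section \<open>Exchanging decreasing and increasing chains\<close>

definition avoids :: "(nat \<Rightarrow> nat \<Rightarrow> bool) \<Rightarrow> nat \<Rightarrow> nat list \<Rightarrow> bool" where
  "avoids R t w \<longleftrightarrow>
     \<not> (\<exists>b s. subseq (b # s) w \<and> sorted_wrt R s \<and> length s = t \<and> (\<forall>x\<in>set s. x < b))"

lemma avoids_Nil [simp]: "avoids R t []"
  by (simp add: avoids_def)

lemma avoids_Cons: "avoids R t (b # w) \<longleftrightarrow> \<not> chain R t (\<lambda>x. x < b) w \<and> avoids R t w"
proof -
  have "subseq (c # s) (b # w) \<longleftrightarrow> subseq (c # s) w \<or> (c = b \<and> subseq s w)" for c s
    using subseq_Cons' by (auto simp: subseq_Cons2_iff)
  then show ?thesis unfolding avoids_def chain_def by blast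
qed

lemma chain_mono: "chain R t P u \<Longrightarrow> (\<And>x. P x \<Longrightarrow> Q x) \<Longrightarrow> chain R t Q u"
  unfolding chain_def by blast

text \<open>A forbidden chain below \<open>x\<close> is also one below \<open>m\<close>, so
  \<open>x\<close> need not be tested itself.\<close>

lemma avoids_Cons_less:
  "t > 0 \<Longrightarrow> x < m \<Longrightarrow>
    avoids R t (m # x # u) \<longleftrightarrow> \<not> chain R t (\<lambda>y. y < m) (x # u) \<and> avoids R t (m # u)"
  using chain_mono[of R t "\<lambda>y. y < x" u "\<lambda>y. y < m"]
  by (auto simp: avoids_Cons chain_Cons[of t])

text \<open>Allows the recursion to start with the bound 0, as if the word were preceded by a
  harmless letter.\<close>

lemma avoids_Cons_0: "t > 0 \<Longrightarrow> avoids R t (0 # w) \<longleftrightarrow> avoids R t w"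
  by (auto simp: avoids_Cons chain_def)

definition size_shape :: "(nat \<Rightarrow> nat) \<Rightarrow> nat" where
  "size_shape f = (\<Sum>c | f c \<noteq> 0. f c)"

lemma size_shape_bump:
  assumes "is_shape f"
  shows "size_shape (bump f j) = Suc (size_shape f)"
proof -
  obtain N where N: "f N = 0" using assms by (auto simp: is_shape_def)
  have fin: "{c. f c \<noteq> 0} \<subseteq> {..<N}"
  proof
    fix c assume "c \<in> {c. f c \<noteq> 0}"
    then show "c \<in> {..<N}" using part_antimono[OF assms, of N c] N by (cases "N \<le> c") auto
  qed
  let ?M = "{..<N + Suc j}"
  have "size_shape f = sum f ?M"
    unfolding size_shape_def using fin by (intro sum.mono_neutral_left) auto
  moreover have "size_shape (bump f j) = sum (bump f j) ?M"
    unfolding size_shape_def using fin by (intro sum.mono_neutral_left) (auto simp: bump_simps split: if_splits)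
  moreover have "sum (bump f j) ?M = (\<Sum>c\<in>?M. f c + (if c = j then 1 else 0))"
    by (intro sum.cong) (auto simp: bump_simps)
  ultimately show ?thesis by (simp add: sum.distrib)
qed

text \<open>The multiset \<open>C\<close> of letters \<open>\<ge> m\<close> after prepending \<open>x \<ge> m\<close> is determined by that of the letters
  \<open>\<ge> x\<close> before, called \<open>C'\<close>, and the tableau \<open>S\<close> of the letters below \<open>x\<close>.\<close>

definition content_rel :: "nat \<Rightarrow> nat \<Rightarrow> (nat \<Rightarrow> nat) list \<Rightarrow> nat multiset \<Rightarrow> nat multiset \<Rightarrow> bool" where
  "content_rel m x S C C' \<longleftrightarrow> (\<forall>v. count C v = (if v = x then 1 else 0) + count C' v +
     (if m \<le> v \<and> v < x then size_shape (level (Suc v) S) - size_shape (level v S) else 0))"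

lemma level_ge: "length T \<le> v \<Longrightarrow> level v T = top_shape T"
  by (cases T) auto

text \<open>Levels stacked on \<open>T\<close> see only its top shape. With the next two lemmas this
  lets tableaux of equal shape be extended by the same levels.\<close>

lemma level_append_cong:
  "length T1 = length T2 \<Longrightarrow> top_shape T1 = top_shape T2 \<Longrightarrow> length T1 \<le> v \<Longrightarrow>
    level v (E @ T1) = level v (E @ T2)"
  by (induction E) (auto simp: level_ge)

lemma gt_append_cong:
  "gt_pattern T1 \<Longrightarrow> gt_pattern T2 \<Longrightarrow> top_shape T1 = top_shape T2 \<Longrightarrow>
    gt_pattern (E @ T1) \<longleftrightarrow> gt_pattern (E @ T2)"
proof (induction E)
  case (Cons g E)
  then show ?case by (cases E) auto
qed auto

lemma content_rel_cong:
  "length T1 = length T2 \<Longrightarrow> top_shape T1 = top_shape T2 \<Longrightarrow> length T1 \<le> m \<Longrightarrow>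
    content_rel m x (E @ T1) C C' \<longleftrightarrow> content_rel m x (E @ T2) C C'"
  unfolding content_rel_def using level_append_cong[of T1 T2 _ E] by (auto cong: if_cong)

lemma gt_top_zero: "gt_pattern T \<Longrightarrow> top_shape T = (\<lambda>_. 0) \<Longrightarrow> T = replicate (length T) (\<lambda>_. 0)"
proof (induction T)
  case (Cons g T)
  then have "top_shape T = (\<lambda>_. 0)" by (auto simp: strip_def)
  then show ?case using Cons by simp
qed auto

lemma count_filter_less:
  "length (filter (\<lambda>y. y < Suc v) u) = length (filter (\<lambda>y. y < v) u) + count (mset u) v"
  by (induction u) auto

lemma (in insertion) size_tab: "size_shape (top_shape (tableau m u)) = length (filter (\<lambda>y. y < m) u)"
proof (induction u)
  case Nil
  then show ?case by (cases m) (auto simp: size_shape_def)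
next
  case (Cons x u)
  show ?case
  proof (cases "x < m")
    case True
    then have ne: "tableau m u \<noteq> []" by (metis length_tab length_0_conv less_zeroE)
    then show ?thesis using True Cons by (simp add: top_ins size_shape_bump gt_part gt_tab)
  qed (use Cons in simp)
qed

lemma (in insertion) content_rel_tab:
  assumes "m \<le> x"
  shows "mset (filter (\<lambda>y. m \<le> y) (x # u)) = C \<longleftrightarrow>
    content_rel m x (tableau x u) C (mset (filter (\<lambda>y. x \<le> y) u))"
proof -
  have c: "size_shape (level (Suc v) (tableau x u)) - size_shape (level v (tableau x u)) = count (mset u) v"
    if "v < x" for v
    using that count_filter_less[of v u] by (simp add: level_tab size_tab)
  have e: "count (mset (filter (\<lambda>y. m \<le> y) (x # u))) v =
      (if v = x then 1 else 0) + count (mset (filter (\<lambda>y. x \<le> y) u)) v +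
     (if m \<le> v \<and> v < x then size_shape (level (Suc v) (tableau x u)) - size_shape (level v (tableau x u)) else 0)" for v
    by (cases "v < x") (use assms c[of v] in auto)
  show ?thesis
    unfolding content_rel_def multiset_eq_iff
    by (intro iff_allI, subst e, rule eq_commute)
qed

section \<open>Words sorted by the shape of their tableau\<close>

locale schensted = insertion +
  fixes R :: "nat \<Rightarrow> nat \<Rightarrow> bool"
  assumes chain_iff: "t > 0 \<Longrightarrow> chain R t (\<lambda>y. y < m) u \<longleftrightarrow> top_shape (tableau m u) (t - 1) \<noteq> 0"
begin

text \<open>Here \<open>m\<close> stands for the maximum of the unread letters, which lie to the left of \<open>u\<close>; only letters
  of \<open>u\<close> below \<open>m\<close> can still become part of a forbidden chain.\<close>

definition words_to :: "nat \<Rightarrow> nat \<Rightarrow> nat multiset \<Rightarrow> nat \<Rightarrow> (nat \<Rightarrow> nat) list \<Rightarrow> nat list set" where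
  "words_to t n C m T = {u. length u = n \<and> mset (filter (\<lambda>y. m \<le> y) u) = C \<and> tableau m u = T \<and> avoids R t (m # u)}"

fun tag :: "nat \<Rightarrow> nat list \<Rightarrow> (nat \<Rightarrow> nat) + (nat \<times> (nat \<Rightarrow> nat) list \<times> nat multiset)" where
  "tag m [] = undefined"
| "tag m (x # u) = (if x < m then Inl (top_shape (tableau m u))
     else Inr (x, take (x - m) (tableau x u), mset (filter (\<lambda>y. x \<le> y) u)))"

lemma wds_gt: "u \<in> words_to t n C m T \<Longrightarrow> gt_pattern T"
  by (auto simp: words_to_def gt_tab)

lemma wds_Cons_less:
  assumes "t > 0" "x < m"
  shows "x # u \<in> words_to t (Suc n) C m T \<longleftrightarrow>
    u \<in> words_to t n C m (tableau m u) \<and> insert_letter x (tableau m u) = T \<and> top_shape T (t - 1) = 0"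
  using assms chain_iff[OF assms(1), of m "x # u"]
  by (auto simp: words_to_def avoids_Cons_less)

text \<open>Now \<open>x\<close> takes over as the bound for the rest; \<open>tableau m u\<close> is
  a tail of \<open>tableau x u\<close>, and the letters from \<open>m\<close> up to \<open>x\<close>
  reappear in the content.\<close>

lemma wds_Cons_ge:
  assumes "t > 0" "m \<le> x"
  shows "x # u \<in> words_to t (Suc n) C m T \<longleftrightarrow>
    u \<in> words_to t n (mset (filter (\<lambda>y. x \<le> y) u)) x (tableau x u) \<and> tableau m u = T \<and> top_shape T (t - 1) = 0 \<and>
    content_rel m x (tableau x u) C (mset (filter (\<lambda>y. x \<le> y) u))"
proof -
  have "avoids R t (m # x # u) \<longleftrightarrow> \<not> chain R t (\<lambda>y. y < m) (x # u) \<and> avoids R t (x # u)"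
    by (rule avoids_Cons)
  also have "\<dots> \<longleftrightarrow> top_shape (tableau m u) (t - 1) = 0 \<and> avoids R t (x # u)"
    using chain_iff[OF assms(1), of m "x # u"] assms(2) by simp
  finally have *: "avoids R t (m # x # u) \<longleftrightarrow> top_shape (tableau m u) (t - 1) = 0 \<and> avoids R t (x # u)" .
  show ?thesis
    using * content_rel_tab[OF assms(2), of u C] assms(2)
    unfolding words_to_def mem_Collect_eq by (auto simp del: filter.simps)
qed

lemma fiber_less_empty:
  assumes "t > 0" "{u \<in> words_to t (Suc n) C m T. tag m u = Inl g} \<noteq> {}"
  shows "is_shape g \<and> top_shape T (t - 1) = 0 \<and> (\<exists>j. bump g j = top_shape T)"
proof -
  from assms(2) obtain u where u: "u \<in> words_to t (Suc n) C m T" "tag m u = Inl g" by auto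
  then obtain x v where xv: "u = x # v" by (cases u) (auto simp: words_to_def)
  have x: "x < m" "top_shape (tableau m v) = g" using u(2) xv by (auto split: if_splits)
  have "tableau m v \<noteq> []" using x by (metis length_tab length_0_conv less_zeroE)
  then show ?thesis
    using u(1) x wds_Cons_less[OF assms(1) x(1), of v n C T] top_ins[of "tableau m v" x] gt_part[OF gt_tab, of m v]
    unfolding xv by metis
qed

text \<open>By \<open>unins\<close> the old shape \<open>g\<close> leaves exactly one first letter
  and one earlier tableau, so the fibre is a copy of a set of shorter words.\<close>

lemma fiber_less:
  assumes "t > 0" "gt_pattern T" "length T = m" "is_shape g" "top_shape T (t - 1) = 0" "bump g j = top_shape T"
  obtains x S where "gt_pattern S" "length S = m" "top_shape S = g"
    "{u \<in> words_to t (Suc n) C m T. tag m u = Inl g} = (#) x ` words_to t n C m S"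
proof -
  obtain p where p: "fst p < length T \<and> gt_pattern (snd p) \<and> length (snd p) = length T \<and>
    top_shape (snd p) = g \<and> insert_letter (fst p) (snd p) = T"
    and pu: "\<And>q. fst q < length T \<and> gt_pattern (snd q) \<and> length (snd q) = length T \<and>
    top_shape (snd q) = g \<and> insert_letter (fst q) (snd q) = T \<Longrightarrow> q = p"
    using unins[OF assms(2,4,6)] by blast
  obtain x S where xS: "p = (x, S)" by (cases p)
  have "{u \<in> words_to t (Suc n) C m T. tag m u = Inl g} = (#) x ` words_to t n C m S"
  proof (intro set_eqI iffI)
    fix u assume "u \<in> {u \<in> words_to t (Suc n) C m T. tag m u = Inl g}"
    then have u: "u \<in> words_to t (Suc n) C m T" "tag m u = Inl g" by auto
    then obtain y v where yv: "u = y # v" by (cases u) (auto simp: words_to_def)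
    have y: "y < m" "top_shape (tableau m v) = g" using u(2) yv by (auto split: if_splits)
    have w: "v \<in> words_to t n C m (tableau m v)" "insert_letter y (tableau m v) = T"
      using u(1) wds_Cons_less[OF assms(1) y(1), of v n C T] unfolding yv by auto
    have "(y, tableau m v) = p" using w y assms(3) by (intro pu) (auto simp: gt_tab)
    then show "u \<in> (#) x ` words_to t n C m S" using w yv xS by auto
  next
    fix u assume "u \<in> (#) x ` words_to t n C m S"
    then obtain v where v: "u = x # v" "v \<in> words_to t n C m S" by auto
    then have "tableau m v = S" by (simp add: words_to_def)
    then show "u \<in> {u \<in> words_to t (Suc n) C m T. tag m u = Inl g}"
      using v p xS assms wds_Cons_less[OF assms(1), of x m v n C T] by auto
  qed
  then show ?thesis using that p xS assms(3) by auto
qed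

text \<open>The tag supplies what \<open>T\<close> does not show: \<open>E @ T\<close> is the
  tableau of all letters below \<open>x\<close>, and \<open>C'\<close> the content from
  \<open>x\<close> on.\<close>

lemma fiber_ge:
  assumes "t > 0" "length T = m"
  shows "{u \<in> words_to t (Suc n) C m T. tag m u = Inr (x, E, C')} =
    (if m \<le> x \<and> length E = x - m \<and> top_shape T (t - 1) = 0 \<and> content_rel m x (E @ T) C C'
     then (#) x ` words_to t n C' x (E @ T) else {})"
proof -
  have "u \<in> words_to t (Suc n) C m T \<and> tag m u = Inr (x, E, C') \<longleftrightarrow>
     (\<exists>v. u = x # v \<and> m \<le> x \<and> length E = x - m \<and> top_shape T (t - 1) = 0 \<and>
        content_rel m x (E @ T) C C' \<and> v \<in> words_to t n C' x (E @ T))" (is "?l \<longleftrightarrow> ?r") for u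
  proof
    assume l: ?l
    then obtain y v where yv: "u = y # v" by (cases u) (auto simp: words_to_def)
    have y: "y = x" "m \<le> x" "take (x - m) (tableau x v) = E" "mset (filter (\<lambda>y. x \<le> y) v) = C'"
      using l yv by (auto split: if_splits)
    note w = wds_Cons_ge[OF assms(1) y(2), of v n C T]
    have T: "tableau m v = T" using w l y yv by auto
    then have ET: "tableau x v = E @ T" using y(2,3) drop_tab[of m x v] by (metis append_take_drop_id)
    moreover have "length E = x - m" using y(3) by auto
    ultimately show ?r using w l y yv by auto
  next
    assume ?r
    then obtain v where v: "u = x # v" "m \<le> x" "length E = x - m" "top_shape T (t - 1) = 0"
      "content_rel m x (E @ T) C C'" "v \<in> words_to t n C' x (E @ T)" by blast
    have vv: "tableau x v = E @ T" "mset (filter (\<lambda>y. x \<le> y) v) = C'" using v(6) by (auto simp: words_to_def)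
    then have "tableau m v = T" using drop_tab[of m x v] v(2,3) by simp
    then show ?l using v vv wds_Cons_ge[OF assms(1) v(2), of v n C T] by auto
  qed
  then show ?thesis by auto
qed

lemma wds_0: "gt_pattern T \<Longrightarrow> length T = m \<Longrightarrow> t > 0 \<Longrightarrow>
  words_to t 0 C m T = (if C = {#} \<and> top_shape T = (\<lambda>_. 0) then {[]} else {})"
proof -
  assume T: "gt_pattern T" "length T = m" "t > 0"
  have "replicate m (\<lambda>_. 0) = T \<longleftrightarrow> top_shape T = (\<lambda>_. 0)"
  proof
    assume "replicate m (\<lambda>_. 0) = T"
    then show "top_shape T = (\<lambda>_. 0)" by (cases m) auto
  qed (use gt_top_zero T in auto)
  then show ?thesis using T(3) by (auto simp: words_to_def avoids_Cons)
qed

end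

lemma eqpoll_fibers:
  assumes "\<And>i. {u \<in> A. f u = i} \<approx> {u \<in> B. h u = i}"
  shows "A \<approx> B"
proof -
  have "(\<Union>i. {u \<in> A. f u = i}) \<approx> (\<Union>i. {u \<in> B. h u = i})"
    using assms by (intro UN_eqpoll_UN) (auto simp: pairwise_def disjnt_def)
  moreover have "(\<Union>i. {u \<in> A. f u = i}) = A" "(\<Union>i. {u \<in> B. h u = i}) = B" by auto
  ultimately show ?thesis by simp
qed

lemma eqpoll_image_Cons: "A \<approx> B \<Longrightarrow> (#) x ` A \<approx> (#) y ` B"
  by (meson eqpoll_sym eqpoll_trans inj_on_Cons1 inj_on_image_eqpoll_self)

text \<open>The tags sort the words by what the first letter does: if it was inserted, by the shape before the
  insertion; if it is a new maximum, by the levels of the tableau that it discards. Both kinds of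
  tags depend on the tableau only through its shape, so they match for the two insertions.\<close>

lemma wds_eqpoll:
  assumes 1: "schensted st1 sp1 R1" and 2: "schensted st2 sp2 R2" and t: "t > 0"
    and T: "gt_pattern T1" "gt_pattern T2" "length T1 = m" "length T2 = m" "top_shape T1 = top_shape T2"
  shows "schensted.words_to st1 sp1 R1 t n C m T1 \<approx> schensted.words_to st2 sp2 R2 t n C m T2"
proof -
  interpret A: schensted st1 sp1 R1 by (rule 1)
  interpret B: schensted st2 sp2 R2 by (rule 2)
  show ?thesis using T
  proof (induction n arbitrary: C m T1 T2)
    case 0
    then show ?case using t by (simp add: A.wds_0 B.wds_0)
  next
    case (Suc n)
    note top = Suc.prems(5)
    show ?case
    proof (rule eqpoll_fibers)
      fix i
      show "{u \<in> A.words_to t (Suc n) C m T1. A.tag m u = i} \<approx> {u \<in> B.words_to t (Suc n) C m T2. B.tag m u = i}"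
      proof (cases i)
        case (Inl g)
        show ?thesis
        proof (cases "is_shape g \<and> top_shape T1 (t - 1) = 0 \<and> (\<exists>j. bump g j = top_shape T1)")
          case False
          then have "{u \<in> A.words_to t (Suc n) C m T1. A.tag m u = Inl g} = {}"
            "{u \<in> B.words_to t (Suc n) C m T2. B.tag m u = Inl g} = {}"
            using A.fiber_less_empty[OF t, of n C m T1 g] B.fiber_less_empty[OF t, of n C m T2 g] top by metis+
          then show ?thesis unfolding Inl by (simp only: eqpoll_refl)
        next
          case True
          then obtain j where j: "is_shape g" "top_shape T1 (t - 1) = 0" "bump g j = top_shape T1" by blast
          obtain x S where S: "gt_pattern S" "length S = m" "top_shape S = g"
            "{u \<in> A.words_to t (Suc n) C m T1. A.tag m u = Inl g} = (#) x ` A.words_to t n C m S"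
            by (rule A.fiber_less[OF t Suc.prems(1,3) j, where n = n and C = C])
          obtain x' S' where S': "gt_pattern S'" "length S' = m" "top_shape S' = g"
            "{u \<in> B.words_to t (Suc n) C m T2. B.tag m u = Inl g} = (#) x' ` B.words_to t n C m S'"
            by (rule B.fiber_less[OF t Suc.prems(2,4) j[unfolded top], where n = n and C = C])
          \<comment> \<open>The letters \<open>x\<close> and \<open>x'\<close> and the entries of
            \<open>S\<close> and \<open>S'\<close> may differ; sharing the shape \<open>g\<close> is
            all the induction needs.\<close>
          have "A.words_to t n C m S \<approx> B.words_to t n C m S'" using S S' by (intro Suc.IH) auto
          then show ?thesis unfolding Inl S(4) S'(4) by (rule eqpoll_image_Cons)
        qed
      next
        case (Inr p)
        obtain x E C' where p: "p = (x, E, C')" by (cases p)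
        show ?thesis
        proof (cases "m \<le> x \<and> length E = x - m \<and> top_shape T1 (t - 1) = 0 \<and> content_rel m x (E @ T1) C C'")
          case False
          moreover have "content_rel m x (E @ T1) C C' \<longleftrightarrow> content_rel m x (E @ T2) C C'"
            using Suc.prems by (intro content_rel_cong) auto
          ultimately show ?thesis
            unfolding Inr p A.fiber_ge[OF t Suc.prems(3)] B.fiber_ge[OF t Suc.prems(4)] using top by auto
        next
          case True
          have c: "content_rel m x (E @ T1) C C' \<longleftrightarrow> content_rel m x (E @ T2) C C'"
            using Suc.prems by (intro content_rel_cong) auto
          have "A.words_to t n C' x (E @ T1) \<approx> B.words_to t n C' x (E @ T2)"
          proof (cases "gt_pattern (E @ T1)")
            case gt_pattern: True
            then have "gt_pattern (E @ T2)" using gt_append_cong[OF Suc.prems(1,2) top] by simp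
            moreover have "top_shape (E @ T1) = top_shape (E @ T2)" using top by (cases E) auto
            ultimately show ?thesis using gt_pattern True Suc.prems by (intro Suc.IH) auto
          next
            case False
            then have "\<not> gt_pattern (E @ T2)" using gt_append_cong[OF Suc.prems(1,2) top] by simp
            then have "A.words_to t n C' x (E @ T1) = {}" "B.words_to t n C' x (E @ T2) = {}"
              using False A.wds_gt B.wds_gt by blast+
            then show ?thesis by simp
          qed
          then show ?thesis
            unfolding Inr p A.fiber_ge[OF t Suc.prems(3)] B.fiber_ge[OF t Suc.prems(4)]
            using True c top by (simp add: eqpoll_image_Cons)
        qed
      qed
    qed
  qed
qed

theorem avoids_le_ge:
  assumes "t > 0"
  shows "{u. mset u = C \<and> avoids (\<le>) t u} \<approx> {u. mset u = C \<and> avoids (\<ge>) t u}"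
proof -
  interpret J: schensted row_start row_step "(\<ge>)" by unfold_locales (rule row_chain)
  interpret I: schensted col_start col_step "(\<le>)" by unfold_locales (rule col_chain)
  \<comment> \<open>With bound 0 the content is the whole word and the tableau is empty, so no shape
    condition remains.\<close>
  have *: "I.words_to t (size C) C 0 [] = {u. mset u = C \<and> avoids (\<le>) t u}"
    "J.words_to t (size C) C 0 [] = {u. mset u = C \<and> avoids (\<ge>) t u}"
    using assms col.length_tab[of 0] row.length_tab[of 0] unfolding I.words_to_def J.words_to_def
    by (auto simp: avoids_Cons_0 simp del: col.length_tab row.length_tab)
  have "I.words_to t (size C) C 0 [] \<approx> J.words_to t (size C) C 0 []"
    by (rule wds_eqpoll[OF I.schensted_axioms J.schensted_axioms assms]) auto
  then show ?thesis unfolding * .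
qed

section \<open>Exchanging a final descent and a final ascent\<close>

definition avoids_desc :: "nat \<Rightarrow> nat list \<Rightarrow> bool" where
  "avoids_desc r w \<longleftrightarrow> \<not> (\<exists>s b a. subseq (s @ [b, a]) w \<and> sorted_wrt (\<le>) s \<and> length s = r \<and>
     (\<forall>x\<in>set s. x \<le> a) \<and> a < b)"

definition avoids_asc :: "nat \<Rightarrow> nat list \<Rightarrow> bool" where
  "avoids_asc r w \<longleftrightarrow> \<not> (\<exists>s a b. subseq (s @ [a, b]) w \<and> sorted_wrt (\<le>) s \<and> length s = r \<and>
     (\<forall>x\<in>set s. x \<le> a) \<and> a < b)"

text \<open>The letters that may follow a weakly increasing chain of length \<open>j\<close>. This
  is an upper set, hence a threshold; using a set covers the case of no such chain as well.\<close>

definition reach :: "nat list \<Rightarrow> nat \<Rightarrow> nat set" where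
  "reach u j = {a. \<exists>s. subseq s u \<and> sorted_wrt (\<le>) s \<and> length s = j \<and> (\<forall>x\<in>set s. x \<le> a)}"

lemma subseq_append_two_iff:
  "subseq (s @ [c, d]) w \<longleftrightarrow> (\<exists>w1 w2. w = w1 @ c # w2 \<and> subseq s w1 \<and> d \<in> set w2)"
proof
  assume "subseq (s @ [c, d]) w"
  then obtain u v where uv: "w = u @ v" "subseq s u" "subseq [c, d] v"
    by (auto dest: list_emb_appendD)
  obtain v1 v2 where v: "v = v1 @ c # v2" "subseq [d] v2"
    using list_emb_ConsD[OF uv(3)] by auto
  then have "d \<in> set v2" by (simp add: subseq_singleton_left)
  moreover have "subseq s (u @ v1)" using list_emb_append_mono[OF uv(2) list_emb_Nil[of _ v1]] by simp
  ultimately show "\<exists>w1 w2. w = w1 @ c # w2 \<and> subseq s w1 \<and> d \<in> set w2"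
    using uv(1) v(1) by (intro exI[of _ "u @ v1"] exI[of _ v2]) simp
next
  assume "\<exists>w1 w2. w = w1 @ c # w2 \<and> subseq s w1 \<and> d \<in> set w2"
  then obtain w1 w2 where w: "w = w1 @ c # w2" "subseq s w1" "d \<in> set w2" by blast
  have "subseq [c, d] (c # w2)" using w(3) by (simp add: subseq_singleton_left)
  then show "subseq (s @ [c, d]) w" unfolding w(1) using w(2) by (rule list_emb_append_mono[rotated])
qed

text \<open>\<open>b\<close> inherits membership in \<open>reach\<close> from the smaller
  \<open>a\<close>. In this form the condition compares admissible letters only.\<close>

lemma avoids_desc_iff:
  "avoids_desc r w \<longleftrightarrow>
    (\<forall>w1 b w2 a. w = w1 @ b # w2 \<longrightarrow> b \<in> reach w1 r \<longrightarrow> a \<in> set w2 \<longrightarrow> a \<in> reach w1 r \<longrightarrow> b \<le> a)"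
proof -
  have up: "b \<in> reach w1 r" if "a \<in> reach w1 r" "a < b" for a b w1
    using that unfolding reach_def by fastforce
  have "avoids_desc r w \<longleftrightarrow>
      \<not> (\<exists>w1 b w2 a. w = w1 @ b # w2 \<and> a \<in> set w2 \<and> a \<in> reach w1 r \<and> a < b)"
    unfolding avoids_desc_def subseq_append_two_iff reach_def by blast
  moreover have "b \<le> a \<longleftrightarrow> \<not> a < b" for a b :: nat by linarith
  ultimately show ?thesis using up by metis
qed

lemma avoids_asc_iff:
  "avoids_asc r w \<longleftrightarrow>
    (\<forall>w1 a w2 b. w = w1 @ a # w2 \<longrightarrow> a \<in> reach w1 r \<longrightarrow> b \<in> set w2 \<longrightarrow> b \<le> a)"
proof -
  have "b \<le> a \<longleftrightarrow> \<not> a < b" for a b :: nat by linarith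
  then show ?thesis unfolding avoids_asc_def subseq_append_two_iff reach_def by blast
qed

text \<open>In the sequel \<open>E j\<close> plays the role of \<open>reach u j\<close> for the part \<open>u\<close> of the word read so far.\<close>

fun upd :: "(nat \<Rightarrow> nat set) \<Rightarrow> nat \<Rightarrow> nat \<Rightarrow> nat set" where
  "upd E x 0 = UNIV"
| "upd E x (Suc j) = E (Suc j) \<union> (if x \<in> E j then {x..} else {})"

lemma sorted_wrt_snoc: "sorted_wrt R (s @ [x]) \<longleftrightarrow> sorted_wrt R s \<and> (\<forall>y\<in>set s. R y x)"
  by (auto simp: sorted_wrt_append)

lemma subseq_snoc: "subseq s (u @ [x]) \<longleftrightarrow> subseq s u \<or> (\<exists>s'. s = s' @ [x] \<and> subseq s' u)"
proof
  assume "subseq s (u @ [x])"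
  then obtain s1 s2 where s: "s = s1 @ s2" "subseq s1 u" "subseq s2 [x]"
    by (auto simp: subseq_append_iff)
  then have "s2 = [] \<or> s2 = [x]"
    by (cases s2) (auto simp: subseq_Cons2_iff split: if_splits dest: list_emb_length)
  then show "subseq s u \<or> (\<exists>s'. s = s' @ [x] \<and> subseq s' u)" using s by auto
qed (auto simp: list_emb_append2 intro: list_emb_append_mono)

lemma reach_snoc: "reach (u @ [x]) = upd (reach u) x"
proof
  fix j
  show "reach (u @ [x]) j = upd (reach u) x j"
  proof (cases j)
    case 0
    then show ?thesis by (auto simp: reach_def)
  next
    case (Suc i)
    have "a \<in> reach (u @ [x]) j \<longleftrightarrow> a \<in> reach u j \<or> (x \<in> reach u i \<and> x \<le> a)" for a
    proof
      assume "a \<in> reach (u @ [x]) j"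
      then obtain s where s: "subseq s (u @ [x])" "sorted_wrt (\<le>) s" "length s = j" "\<forall>x\<in>set s. x \<le> a"
        by (auto simp: reach_def)
      then show "a \<in> reach u j \<or> (x \<in> reach u i \<and> x \<le> a)"
        unfolding subseq_snoc reach_def using Suc by (auto simp: sorted_wrt_snoc)
    next
      assume "a \<in> reach u j \<or> (x \<in> reach u i \<and> x \<le> a)"
      then show "a \<in> reach (u @ [x]) j"
      proof
        assume "a \<in> reach u j"
        then show ?thesis unfolding reach_def subseq_snoc by blast
      next
        assume "x \<in> reach u i \<and> x \<le> a"
        then obtain s where "subseq s u" "sorted_wrt (\<le>) s" "length s = i" "\<forall>y\<in>set s. y \<le> x" "x \<le> a"
          by (auto simp: reach_def)
        then show ?thesis unfolding reach_def subseq_snoc using Suc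
          by (intro CollectI exI[of _ "s @ [x]"]) (auto simp: sorted_wrt_snoc intro: order_trans)
      qed
    qed
    then show ?thesis using Suc by auto
  qed
qed

fun ok_desc :: "nat \<Rightarrow> (nat \<Rightarrow> nat set) \<Rightarrow> nat list \<Rightarrow> bool" where
  "ok_desc r E [] \<longleftrightarrow> True"
| "ok_desc r E (x # w) \<longleftrightarrow> (x \<in> E r \<longrightarrow> (\<forall>a\<in>set w. a \<in> E r \<longrightarrow> x \<le> a)) \<and> ok_desc r (upd E x) w"

fun ok_asc :: "nat \<Rightarrow> (nat \<Rightarrow> nat set) \<Rightarrow> nat list \<Rightarrow> bool" where
  "ok_asc r E [] \<longleftrightarrow> True"
| "ok_asc r E (x # w) \<longleftrightarrow> (x \<in> E r \<longrightarrow> (\<forall>b\<in>set w. b \<le> x)) \<and> ok_asc r (upd E x) w"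

lemma all_split_Cons:
  "(\<forall>w1 b w2. x # w = w1 @ b # w2 \<longrightarrow> P w1 b w2) \<longleftrightarrow>
    P [] x w \<and> (\<forall>w1 b w2. w = w1 @ b # w2 \<longrightarrow> P (x # w1) b w2)"
  by (auto simp: Cons_eq_append_conv)

lemma ok_desc_iff:
  "ok_desc r (reach u) w \<longleftrightarrow>
    (\<forall>w1 b w2. w = w1 @ b # w2 \<longrightarrow>
      (\<forall>a. b \<in> reach (u @ w1) r \<longrightarrow> a \<in> set w2 \<longrightarrow> a \<in> reach (u @ w1) r \<longrightarrow> b \<le> a))"
proof (induction w arbitrary: u)
  case (Cons x w)
  show ?case
    unfolding ok_desc.simps reach_snoc[symmetric] Cons.IH all_split_Cons by auto
qed auto

lemma ok_asc_iff:
  "ok_asc r (reach u) w \<longleftrightarrow>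
    (\<forall>w1 a w2. w = w1 @ a # w2 \<longrightarrow> (\<forall>b. a \<in> reach (u @ w1) r \<longrightarrow> b \<in> set w2 \<longrightarrow> b \<le> a))"
proof (induction w arbitrary: u)
  case (Cons x w)
  show ?case
    unfolding ok_asc.simps reach_snoc[symmetric] Cons.IH all_split_Cons by auto
qed auto

text \<open>Properties of \<open>reach u\<close> preserved by \<open>upd\<close>. They are stated
  for arbitrary families because the two words read different letters and only agree on the sets up
  to \<open>r\<close>.\<close>

definition nested :: "(nat \<Rightarrow> nat set) \<Rightarrow> bool" where
  "nested E \<longleftrightarrow> E 0 = UNIV \<and> (\<forall>j. E (Suc j) \<subseteq> E j) \<and> (\<forall>j x y. x \<in> E j \<longrightarrow> x \<le> y \<longrightarrow> y \<in> E j)"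

lemma nested_upd: "nested E \<Longrightarrow> nested (upd E x)"
proof -
  assume E: "nested E"
  have "upd E x (Suc j) \<subseteq> upd E x j" for j
    using E by (cases j) (auto simp: nested_def)
  moreover have "z \<in> upd E x j" if "y \<in> upd E x j" "y \<le> z" for j y z
    using E that by (cases j) (auto simp: nested_def)
  ultimately show ?thesis by (simp add: nested_def)
qed

lemma nested_mono: "nested E \<Longrightarrow> i \<le> j \<Longrightarrow> E j \<subseteq> E i"
  by (rule lift_Suc_antimono_le) (auto simp: nested_def)

text \<open>\<open>x\<close> lies in every \<open>E j\<close> with \<open>j \<le> r\<close>, and
  these are upper sets, so \<open>{x..}\<close> adds nothing. Whichever admissible letter is placed,
  the later conditions stay the same.\<close>

lemma upd_high:
  assumes "nested E" "x \<in> E r" "j \<le> r"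
  shows "upd E x j = E j"
proof (cases j)
  case 0
  then show ?thesis using assms by (simp add: nested_def)
next
  case (Suc i)
  have "x \<in> E j" using nested_mono[OF assms(1,3)] assms(2) by blast
  then have "{x..} \<subseteq> E j" using assms(1) by (auto simp: nested_def)
  then show ?thesis using Suc by auto
qed

lemma upd_sup: "nested E \<Longrightarrow> E j \<subseteq> upd E x j"
  by (cases j) auto

lemma upd_cong: "(\<And>i. i \<le> r \<Longrightarrow> E1 i = E2 i) \<Longrightarrow> j \<le> r \<Longrightarrow> upd E1 x j = upd E2 x j"
  by (cases j) auto

lemma filter_mset_subset_cong:
  assumes "filter_mset (\<lambda>x. x \<notin> A) c1 = filter_mset (\<lambda>x. x \<notin> A) c2" "A \<subseteq> B"
  shows "filter_mset (\<lambda>x. x \<notin> B) c1 = filter_mset (\<lambda>x. x \<notin> B) c2"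
proof -
  have "filter_mset (\<lambda>x. x \<notin> B) c = filter_mset (\<lambda>x. x \<notin> B) (filter_mset (\<lambda>x. x \<notin> A) c)" for c
    using assms(2) by (auto simp: filter_filter_mset intro!: filter_mset_cong)
  then show ?thesis using assms(1) by metis
qed

lemma high_exists:
  assumes "size c1 = size c2" "filter_mset (\<lambda>x. x \<notin> A) c1 = filter_mset (\<lambda>x. x \<notin> A) c2"
  shows "(\<exists>x. x \<in># c1 \<and> x \<in> A) \<longleftrightarrow> (\<exists>x. x \<in># c2 \<and> x \<in> A)"
proof -
  have "(\<exists>x. x \<in># c \<and> x \<in> A) \<longleftrightarrow> size (filter_mset (\<lambda>x. x \<notin> A) c) < size c" for c
  proof -
    have sz: "size c = size (filter_mset (\<lambda>x. x \<in> A) c) + size (filter_mset (\<lambda>x. x \<notin> A) c)"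
      by (metis multiset_partition size_union)
    have *: "size (filter_mset (\<lambda>x. x \<in> A) c) \<noteq> 0 \<longleftrightarrow> set_mset (filter_mset (\<lambda>x. x \<in> A) c) \<noteq> {}"
      by simp
    have "(\<exists>x. x \<in># c \<and> x \<in> A) \<longleftrightarrow> size (filter_mset (\<lambda>x. x \<in> A) c) \<noteq> 0"
      unfolding *[unfolded set_mset_filter] by blast
    also have "\<dots> \<longleftrightarrow> size (filter_mset (\<lambda>x. x \<notin> A) c) < size c"
      by (rule iffI) (use sz in linarith)+
    finally show ?thesis .
  qed
  then show ?thesis using assms by simp
qed

text \<open>The next letter is either outside \<open>E1 r\<close>, or forced to be the least (respectively greatest)
  remaining letter in \<open>E1 r\<close>. Since \<open>E1 r\<close> only grows, the remaining letters in it matter only through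
  their number.\<close>

lemma ok_desc_ok_asc_eqpoll:
  assumes "nested E1" "nested E2" "\<And>j. j \<le> r \<Longrightarrow> E1 j = E2 j" "size c1 = size c2"
    "filter_mset (\<lambda>x. x \<notin> E1 r) c1 = filter_mset (\<lambda>x. x \<notin> E1 r) c2"
  shows "{w. mset w = c1 \<and> ok_desc r E1 w} \<approx> {w. mset w = c2 \<and> ok_asc r E2 w}"
  using assms
proof (induction "size c1" arbitrary: c1 c2 E1 E2)
  case 0
  then have "c1 = {#}" "c2 = {#}" by auto
  then have "{w. mset w = c1 \<and> ok_desc r E1 w} = {[]}" "{w. mset w = c2 \<and> ok_asc r E2 w} = {[]}" by auto
  then show ?case by (simp only: eqpoll_refl)
next
  case (Suc m)
  note E = Suc.prems(1-3) and sz = Suc.prems(4) and low = Suc.prems(5)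
  have Er: "E2 r = E1 r" using E(3) by simp
  \<comment> \<open>All admissible first letters share the tag \<open>None\<close>, since the two
    sides may have to place different ones.\<close>
  let ?tag = "\<lambda>w. if hd w \<in> E1 r then None else Some (hd w)"
  show ?case
  proof (rule eqpoll_fibers[where f = ?tag and h = ?tag])
    fix i :: "nat option"
    let ?A = "{u \<in> {w. mset w = c1 \<and> ok_desc r E1 w}. ?tag u = i}"
    let ?B = "{u \<in> {w. mset w = c2 \<and> ok_asc r E2 w}. ?tag u = i}"
    have ne: "w \<noteq> []" if "mset w = c1 \<or> mset w = c2" for w using that Suc.hyps(2) sz by auto
    show "?A \<approx> ?B"
    proof (cases i)
      case (Some x)
      show ?thesis
      proof (cases "x \<in># c1 \<and> x \<notin> E1 r")
        case False
        have "x \<in># c2 \<and> x \<notin> E1 r \<longleftrightarrow> x \<in># c1 \<and> x \<notin> E1 r"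
          using arg_cong[OF low, of "\<lambda>M. x \<in># M"] by auto
        then have "?A = {}" "?B = {}" using False Some ne hd_in_set[of _] by (auto split: if_splits)
        then show ?thesis by (simp only: eqpoll_refl)
      next
        case True
        then have xc: "x \<in># c1" "x \<in># c2" "x \<notin> E1 r"
          using arg_cong[OF low, of "\<lambda>M. x \<in># M"] by auto
        have "?A = (#) x ` {w. mset w = c1 - {#x#} \<and> ok_desc r (upd E1 x) w}"
        proof (intro set_eqI iffI)
          fix w assume w: "w \<in> ?A"
          then obtain v where "w = x # v" using ne[of w] Some by (cases w) (auto split: if_splits)
          then show "w \<in> (#) x ` {w. mset w = c1 - {#x#} \<and> ok_desc r (upd E1 x) w}" using w by auto
        qed (use xc Some in auto)
        moreover have "?B = (#) x ` {w. mset w = c2 - {#x#} \<and> ok_asc r (upd E2 x) w}"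
        proof (intro set_eqI iffI)
          fix w assume w: "w \<in> ?B"
          then obtain v where "w = x # v" using ne[of w] Some by (cases w) (auto split: if_splits)
          then show "w \<in> (#) x ` {w. mset w = c2 - {#x#} \<and> ok_asc r (upd E2 x) w}" using w by auto
        next
          fix w assume "w \<in> (#) x ` {w. mset w = c2 - {#x#} \<and> ok_asc r (upd E2 x) w}"
          then obtain v where v: "w = x # v" "mset v = c2 - {#x#}" "ok_asc r (upd E2 x) v" by auto
          have "x \<notin> E2 r" using xc Er by simp
          then show "w \<in> ?B" using v xc Some by simp
        qed
        moreover have "{w. mset w = c1 - {#x#} \<and> ok_desc r (upd E1 x) w} \<approx>
            {w. mset w = c2 - {#x#} \<and> ok_asc r (upd E2 x) w}"
        proof (rule Suc.hyps(1))
          show "m = size (c1 - {#x#})" using Suc.hyps(2) size_Suc_Diff1[OF xc(1)] by linarith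
          show "upd E1 x j = upd E2 x j" if "j \<le> r" for j using upd_cong[of r E1 E2 j x] E(3) that by blast
          show "size (c1 - {#x#}) = size (c2 - {#x#})" using sz size_Suc_Diff1[OF xc(1)] size_Suc_Diff1[OF xc(2)] by linarith
          have "filter_mset (\<lambda>y. y \<notin> E1 r) (c1 - {#x#}) = filter_mset (\<lambda>y. y \<notin> E1 r) (c2 - {#x#})"
            using low by (simp add: filter_diff_mset)
          then show "filter_mset (\<lambda>y. y \<notin> upd E1 x r) (c1 - {#x#}) = filter_mset (\<lambda>y. y \<notin> upd E1 x r) (c2 - {#x#})"
            by (rule filter_mset_subset_cong) (rule upd_sup[OF E(1)])
        qed (use nested_upd E in auto)
        ultimately show ?thesis by (simp only: eqpoll_image_Cons)
      qed
    next
      case None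
      show ?thesis
      proof (cases "\<exists>x. x \<in># c1 \<and> x \<in> E1 r")
        case False
        then have F2: "\<not> (\<exists>x. x \<in># c2 \<and> x \<in> E1 r)" using high_exists[OF sz low] by simp
        have "?A = {}" 
        proof (rule ccontr)
          assume "?A \<noteq> {}"
          then obtain w where w: "mset w = c1" "hd w \<in> E1 r" using None by (auto split: if_splits)
          then show False using False ne[of w] by (metis hd_in_set set_mset_mset)
        qed
        moreover have "?B = {}" 
        proof (rule ccontr)
          assume "?B \<noteq> {}"
          then obtain w where w: "mset w = c2" "hd w \<in> E1 r" using None by (auto split: if_splits)
          then show False using F2 ne[of w] by (metis hd_in_set set_mset_mset)
        qed
        ultimately show ?thesis by (simp only: eqpoll_refl)
      next
        case True
        then have T2: "\<exists>x. x \<in># c2 \<and> x \<in> E1 r" using high_exists[OF sz low] by simp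
        define x where "x = Min {x \<in> set_mset c1. x \<in> E1 r}"
        \<comment> \<open>\<open>E1 r\<close> is an upper set, so once it contains a remaining
          letter, the largest remaining letter is in it.\<close>
        define y where "y = Max (set_mset c2)"
        have "x \<in> {x \<in> set_mset c1. x \<in> E1 r}" unfolding x_def using True by (intro Min_in) auto
        then have x: "x \<in># c1" "x \<in> E1 r" by auto
        have xmin: "x \<le> a" if "a \<in># c1" "a \<in> E1 r" for a unfolding x_def using that by (intro Min_le) auto
        have y: "y \<in># c2" unfolding y_def using T2 by (intro Max_in) auto
        have ymax: "a \<le> y" if "a \<in># c2" for a unfolding y_def using that by (intro Max_ge) auto
        have yE: "y \<in> E1 r" using T2 ymax E(1) unfolding nested_def by blast
        have "?A = (#) x ` {w. mset w = c1 - {#x#} \<and> ok_desc r (upd E1 x) w}"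
        proof (intro set_eqI iffI)
          fix w assume w: "w \<in> ?A"
          then obtain z v where zv: "w = z # v" "z \<in> E1 r" using ne[of w] None by (cases w) (auto split: if_splits)
          then have "\<forall>a\<in>set v. a \<in> E1 r \<longrightarrow> z \<le> a" "add_mset z (mset v) = c1" using w by auto
          then have "z = x" using x zv xmin[of z] by (intro antisym) auto
          then show "w \<in> (#) x ` {w. mset w = c1 - {#x#} \<and> ok_desc r (upd E1 x) w}" using w zv by auto
        next
          fix w assume "w \<in> (#) x ` {w. mset w = c1 - {#x#} \<and> ok_desc r (upd E1 x) w}"
          then obtain v where v: "w = x # v" "mset v = c1 - {#x#}" "ok_desc r (upd E1 x) v" by auto
          have "a \<in># c1" if "a \<in> set v" for a using that v(2) by (metis in_diffD set_mset_mset)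
          then show "w \<in> ?A" using v x xmin None by auto
        qed
        moreover have "?B = (#) y ` {w. mset w = c2 - {#y#} \<and> ok_asc r (upd E2 y) w}"
        proof (intro set_eqI iffI)
          fix w assume w: "w \<in> ?B"
          then obtain z v where zv: "w = z # v" "z \<in> E1 r" using ne[of w] None by (cases w) (auto split: if_splits)
          then have "\<forall>a\<in>set v. a \<le> z" "add_mset z (mset v) = c2" using w Er by auto
          then have "z = y" using y zv ymax[of z] by (intro antisym) auto
          then show "w \<in> (#) y ` {w. mset w = c2 - {#y#} \<and> ok_asc r (upd E2 y) w}" using w zv by auto
        next
          fix w assume "w \<in> (#) y ` {w. mset w = c2 - {#y#} \<and> ok_asc r (upd E2 y) w}"
          then obtain v where v: "w = y # v" "mset v = c2 - {#y#}" "ok_asc r (upd E2 y) v" by auto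
          have "a \<in># c2" if "a \<in> set v" for a using that v(2) by (metis in_diffD set_mset_mset)
          then show "w \<in> ?B" using v y yE ymax None by auto
        qed
        moreover have "{w. mset w = c1 - {#x#} \<and> ok_desc r (upd E1 x) w} \<approx>
            {w. mset w = c2 - {#y#} \<and> ok_asc r (upd E2 y) w}"
        proof (rule Suc.hyps(1))
          show "m = size (c1 - {#x#})" using Suc.hyps(2) size_Suc_Diff1[OF x(1)] by linarith
          \<comment> \<open>\<open>x\<close> and \<open>y\<close> may differ, but neither changes
            the sets up to \<open>r\<close>.\<close>
          show "upd E1 x j = upd E2 y j" if "j \<le> r" for j
            using upd_high[OF E(1) x(2) that] upd_high[OF E(2) _ that, of y] yE Er E(3)[OF that] by simp
          show "size (c1 - {#x#}) = size (c2 - {#y#})" using sz size_Suc_Diff1[OF x(1)] size_Suc_Diff1[OF y] by linarith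
          have "filter_mset (\<lambda>z. z \<notin> E1 r) (c1 - {#x#}) = filter_mset (\<lambda>z. z \<notin> E1 r) (c2 - {#y#})"
            using low x(2) yE by (simp add: filter_diff_mset)
          then show "filter_mset (\<lambda>z. z \<notin> upd E1 x r) (c1 - {#x#}) = filter_mset (\<lambda>z. z \<notin> upd E1 x r) (c2 - {#y#})"
            by (rule filter_mset_subset_cong) (rule upd_sup[OF E(1)])
        qed (use nested_upd E in auto)
        ultimately show ?thesis by (simp only: eqpoll_image_Cons)
      qed
    qed
  qed
qed

lemma avoids_desc_asc:
  "{w. mset w = C \<and> avoids_desc r w} \<approx> {w. mset w = C \<and> avoids_asc r w}"
proof -
  have d: "avoids_desc r w \<longleftrightarrow> ok_desc r (reach []) w" for w
    unfolding avoids_desc_iff ok_desc_iff by auto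
  have a: "avoids_asc r w \<longleftrightarrow> ok_asc r (reach []) w" for w
    unfolding avoids_asc_iff ok_asc_iff by auto
  have "nested (reach [])" by (auto simp: nested_def reach_def)
  then show ?thesis unfolding d a by (intro ok_desc_ok_asc_eqpoll) auto
qed

lemma subseq_imp_subseq_rev: "subseq s w \<Longrightarrow> subseq (rev s) (rev w)"
proof (induction rule: list_emb.induct)
  case (list_emb_Cons2 x y xs ys)
  then show ?case by (auto intro: list_emb_append_mono)
qed (auto intro: list_emb_append_mono[of _ _ _ "[]", simplified])

text \<open>After reversal \<open>b\<close> comes first, and \<open>a\<close> joins the chain as its
  largest letter, which accounts for the length \<open>Suc r\<close>.\<close>

lemma avoids_asc_rev: "avoids_asc r w \<longleftrightarrow> avoids (\<ge>) (Suc r) (rev w)"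
proof -
  have "(\<exists>s a b. subseq (s @ [a, b]) w \<and> sorted_wrt (\<le>) s \<and> length s = r \<and> (\<forall>x\<in>set s. x \<le> a) \<and> a < b) \<longleftrightarrow>
    (\<exists>b s. subseq (b # s) (rev w) \<and> sorted_wrt (\<ge>) s \<and> length s = Suc r \<and> (\<forall>x\<in>set s. x < b))"
    (is "?l \<longleftrightarrow> ?r")
  proof
    assume ?l
    then obtain s a b where s: "subseq (s @ [a, b]) w" "sorted_wrt (\<le>) s" "length s = r" "\<forall>x\<in>set s. x \<le> a" "a < b"
      by blast
    have "subseq (rev (s @ [a, b])) (rev w)" using s(1) by (rule subseq_imp_subseq_rev)
    then have "subseq (b # a # rev s) (rev w)" by simp
    then show ?r using s
      by (intro exI[of _ b] exI[of _ "a # rev s"]) (auto simp: sorted_wrt_rev)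
  next
    assume ?r
    then obtain b s where s: "subseq (b # s) (rev w)" "sorted_wrt (\<ge>) s" "length s = Suc r" "\<forall>x\<in>set s. x < b"
      by blast
    then obtain a s' where as: "s = a # s'" by (cases s) auto
    have "subseq (rev (b # s)) w" using subseq_imp_subseq_rev[OF s(1)] by simp
    then have "subseq (rev s' @ [a, b]) w" using as by simp
    then show ?l using s as
      by (intro exI[of _ "rev s'"] exI[of _ a] exI[of _ b]) (auto simp: sorted_wrt_rev)
  qed
  then show ?thesis unfolding avoids_asc_def avoids_def by simp
qed

theorem avoids_desc_le:
  "{w. mset w = C \<and> avoids_desc r w} \<approx> {w. mset w = C \<and> avoids (\<le>) (Suc r) w}"
proof -
  have "rev ` {w. mset w = C \<and> avoids (\<ge>) (Suc r) w} = {w. mset w = C \<and> avoids_asc r w}"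
  proof (intro set_eqI iffI)
    fix w assume "w \<in> {w. mset w = C \<and> avoids_asc r w}"
    then have "rev w \<in> {w. mset w = C \<and> avoids (\<ge>) (Suc r) w}" by (simp add: avoids_asc_rev)
    then show "w \<in> rev ` {w. mset w = C \<and> avoids (\<ge>) (Suc r) w}" by (metis image_eqI rev_rev_ident)
  qed (auto simp: avoids_asc_rev)
  then have "{w. mset w = C \<and> avoids_asc r w} \<approx> {w. mset w = C \<and> avoids (\<ge>) (Suc r) w}"
    using inj_on_image_eqpoll_self[of rev "{w. mset w = C \<and> avoids (\<ge>) (Suc r) w}"] by simp
  then have "{w. mset w = C \<and> avoids_desc r w} \<approx> {w. mset w = C \<and> avoids (\<ge>) (Suc r) w}"
    by (rule eqpoll_trans[OF avoids_desc_asc])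
  then show ?thesis
    by (rule eqpoll_trans) (rule eqpoll_sym[OF avoids_le_ge[OF zero_less_Suc]])
qed

section \<open>Permutations as words\<close>

text \<open>Positions between consecutive elements of \<open>S\<close> form a block; \<open>block S i\<close> numbers the block of \<open>i\<close>. A
  permutation without descents outside \<open>S\<close> increases on each block.\<close>

definition block :: "nat set \<Rightarrow> nat \<Rightarrow> nat" where
  "block S i = card {s \<in> S. s < i}"

definition key_word :: "nat \<Rightarrow> nat set \<Rightarrow> (nat \<Rightarrow> nat) \<Rightarrow> nat list" where
  "key_word n S \<pi> = map (\<lambda>v. block S (inv \<pi> v)) [1..<Suc n]"

lemma block_mono: "finite S \<Longrightarrow> i \<le> j \<Longrightarrow> block S i \<le> block S j"
  unfolding block_def by (intro card_mono) auto

lemma block_eqD: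
  assumes "finite S" "block S i = block S j" "i \<le> s" "s < j"
  shows "s \<notin> S"
proof
  assume "s \<in> S"
  then have "s \<in> {s \<in> S. s < j}" "s \<notin> {s \<in> S. s < i}" using assms(3,4) by auto
  moreover have "{s \<in> S. s < i} \<subseteq> {s \<in> S. s < j}" using assms(3,4) by auto
  ultimately have "{s \<in> S. s < i} \<subset> {s \<in> S. s < j}" by blast
  then have "block S i < block S j" unfolding block_def using assms(1) by (intro psubset_card_mono) auto
  then show False using assms(2) by simp
qed

lemma block_Suc: "i \<notin> S \<Longrightarrow> block S (Suc i) = block S i"
proof -
  assume "i \<notin> S"
  then have "{s \<in> S. s < Suc i} = {s \<in> S. s < i}" by (auto simp: less_Suc_eq)
  then show ?thesis by (simp add: block_def)
qed

lemma increasing_in_block: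
  assumes "\<pi> permutes {1..n}" "descent_set n \<pi> \<subseteq> S" "finite S"
    and "i < j" "1 \<le> i" "j \<le> n" "block S i = block S j"
  shows "\<pi> i < \<pi> j"
proof -
  have step: "\<pi> s < \<pi> (Suc s)" if "i \<le> s" "s < j" for s
  proof -
    have "s \<notin> descent_set n \<pi>" using block_eqD[OF assms(3,7) that] assms(2) by blast
    then have "\<pi> s \<le> \<pi> (Suc s)" using that assms by (auto simp: descent_set_def)
    moreover have "\<pi> s \<noteq> \<pi> (Suc s)" using permutes_inj[OF assms(1)] by (metis injD n_not_Suc_n)
    ultimately show ?thesis by simp
  qed
  have "j' \<le> j \<longrightarrow> \<pi> i < \<pi> j'" if "Suc i \<le> j'" for j'
    using that
  proof (induction j' rule: dec_induct)
    case base
    then show ?case using step[of i] assms(4) by simp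
  next
    case (step m)
    then show ?case using \<open>\<And>s. i \<le> s \<Longrightarrow> s < j \<Longrightarrow> \<pi> s < \<pi> (Suc s)\<close>[of m] by auto
  qed
  then show ?thesis using assms(4) by simp
qed

text \<open>Positions compare first by block and, inside a block, by value because
  \<open>\<pi>\<close> increases there. So blocks and values determine the order of
  positions.\<close>

lemma inv_less_iff:
  assumes "\<pi> permutes {1..n}" "descent_set n \<pi> \<subseteq> S" "finite S" "u \<in> {1..n}" "v \<in> {1..n}"
  shows "inv \<pi> u < inv \<pi> v \<longleftrightarrow> block S (inv \<pi> u) < block S (inv \<pi> v) \<or>
    (block S (inv \<pi> u) = block S (inv \<pi> v) \<and> u < v)"
proof -
  have in_n: "inv \<pi> x \<in> {1..n}" if "x \<in> {1..n}" for x
    using permutes_in_image[OF permutes_inv[OF assms(1)]] that by blast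
  have inv: "\<pi> (inv \<pi> x) = x" for x using permutes_inverses(1)[OF assms(1)] .
  have aux: "x < y" if "inv \<pi> x < inv \<pi> y" "block S (inv \<pi> x) = block S (inv \<pi> y)" "x \<in> {1..n}" "y \<in> {1..n}" for x y
    using increasing_in_block[OF assms(1-3) that(1) _ _ that(2)] in_n[OF that(3)] in_n[OF that(4)] inv by auto
  show ?thesis
  proof
    assume l: "inv \<pi> u < inv \<pi> v"
    then have "block S (inv \<pi> u) \<le> block S (inv \<pi> v)" using block_mono[OF assms(3)] by simp
    then show "block S (inv \<pi> u) < block S (inv \<pi> v) \<or>
      (block S (inv \<pi> u) = block S (inv \<pi> v) \<and> u < v)"
      using aux[OF l _ assms(4,5)] by linarith
  next
    assume r: "block S (inv \<pi> u) < block S (inv \<pi> v) \<or>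
      (block S (inv \<pi> u) = block S (inv \<pi> v) \<and> u < v)"
    show "inv \<pi> u < inv \<pi> v"
    proof (rule ccontr)
      assume n: "\<not> inv \<pi> u < inv \<pi> v"
      then have "block S (inv \<pi> v) \<le> block S (inv \<pi> u)" using block_mono[OF assms(3)] by simp
      then have e: "block S (inv \<pi> v) = block S (inv \<pi> u)" "u < v" using r by linarith+
      then have "inv \<pi> u \<noteq> inv \<pi> v" using inv by (metis less_irrefl)
      then have "inv \<pi> v < inv \<pi> u" using n by linarith
      then show False using aux[OF _ e(1) assms(5,4)] e(2) by simp
    qed
  qed
qed

text \<open>The inverse view of an occurrence: \<open>js\<close> lists it by value instead of
  position, and \<open>js ! (\<tau> a - 1)\<close> is the value at its \<open>a\<close>-th position.
  Words indexed by values require this form.\<close>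

lemma contains_pattern_iff:
  assumes "\<pi> permutes {1..n}" "\<tau> permutes {1..k}"
  shows "contains_pattern n \<pi> k \<tau> \<longleftrightarrow>
    (\<exists>js. length js = k \<and> sorted_wrt (<) js \<and> set js \<subseteq> {1..n} \<and>
       sorted_wrt (\<lambda>u v. inv \<pi> u < inv \<pi> v) (map (\<lambda>a. js ! (\<tau> a - 1)) [1..<Suc k]))"
    (is "?l \<longleftrightarrow> (\<exists>js. ?r js)")
proof
  assume ?l
  then obtain i where i: "strict_mono_on {1..k} i" "i ` {1..k} \<subseteq> {1..n}"
    "\<And>a b. a \<in> {1..k} \<Longrightarrow> b \<in> {1..k} \<Longrightarrow> \<pi> (i a) < \<pi> (i b) \<longleftrightarrow> \<tau> a < \<tau> b"
    unfolding contains_pattern_def by blast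
  define js where "js = map (\<lambda>a. \<pi> (i (inv \<tau> a))) [1..<Suc k]"
  have js: "js ! a = \<pi> (i (inv \<tau> (Suc a)))" if "a < k" for a
    using that unfolding js_def by (subst nth_map) (auto simp del: upt_Suc)
  have it: "inv \<tau> a \<in> {1..k}" if "a \<in> {1..k}" for a
    using permutes_in_image[OF permutes_inv[OF assms(2)]] that by blast
  have len: "length js = k" by (simp add: js_def)
  have "sorted_wrt (<) js"
    unfolding sorted_wrt_iff_nth_less len
    using i(3) it js permutes_inverses(1)[OF assms(2)] by auto
  moreover have "set js \<subseteq> {1..n}"
  proof
    fix x assume "x \<in> set js"
    then obtain a where "a \<in> {1..k}" "x = \<pi> (i (inv \<tau> a))" unfolding js_def by (auto simp: less_Suc_eq_le simp del: upt_Suc)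
    then show "x \<in> {1..n}" using it i(2) permutes_in_image[OF assms(1)] by blast
  qed
  moreover have "js ! (\<tau> a - 1) = \<pi> (i a)" if "a \<in> {1..k}" for a
  proof -
    have "\<tau> a \<in> {1..k}" using permutes_in_image[OF assms(2)] that by blast
    then show ?thesis using js[of "\<tau> a - 1"] permutes_inverses(2)[OF assms(2)] by auto
  qed
  then have "sorted_wrt (\<lambda>u v. inv \<pi> u < inv \<pi> v) (map (\<lambda>a. js ! (\<tau> a - 1)) [1..<Suc k])"
    unfolding sorted_wrt_iff_nth_less using i(1) permutes_inverses(2)[OF assms(1)]
    by (auto simp: strict_mono_on_def simp del: upt_Suc)
  ultimately show "\<exists>js. ?r js" using len by blast
next
  assume "\<exists>js. ?r js"
  then obtain js where js: "length js = k" "sorted_wrt (<) js" "set js \<subseteq> {1..n}"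
    "sorted_wrt (\<lambda>u v. inv \<pi> u < inv \<pi> v) (map (\<lambda>a. js ! (\<tau> a - 1)) [1..<Suc k])" by blast
  define i where "i a = inv \<pi> (js ! (\<tau> a - 1))" for a
  have t: "\<tau> a \<in> {1..k}" if "a \<in> {1..k}" for a
    using permutes_in_image[OF assms(2)] that by blast
  have jless: "js ! a < js ! b \<longleftrightarrow> a < b" if "a < k" "b < k" for a b
    using js(1,2) that by (metis linorder_neqE_nat not_less_iff_gr_or_eq sorted_wrt_nth_less)
  have "i a < i b" if "a \<in> {1..k}" "b \<in> {1..k}" "a < b" for a b
  proof -
    have "map (\<lambda>a. js ! (\<tau> a - 1)) [1..<Suc k] ! (a - 1) = js ! (\<tau> a - 1)"
      "map (\<lambda>a. js ! (\<tau> a - 1)) [1..<Suc k] ! (b - 1) = js ! (\<tau> b - 1)"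
      using that by (subst nth_map; auto simp del: upt_Suc)+
    then show ?thesis
      using sorted_wrt_nth_less[OF js(4), of "a - 1" "b - 1"] that unfolding i_def
      by (auto simp del: upt_Suc)
  qed
  then have "strict_mono_on {1..k} i" by (auto simp: strict_mono_on_def)
  moreover have "i ` {1..k} \<subseteq> {1..n}"
  proof
    fix x assume "x \<in> i ` {1..k}"
    then obtain a where a: "a \<in> {1..k}" "x = inv \<pi> (js ! (\<tau> a - 1))" unfolding i_def by auto
    have "js ! (\<tau> a - 1) \<in> set js" using t[OF a(1)] js(1) by (intro nth_mem) auto
    then show "x \<in> {1..n}" using a(2) js(3) permutes_in_image[OF permutes_inv[OF assms(1)]] by blast
  qed
  moreover have "\<pi> (i a) < \<pi> (i b) \<longleftrightarrow> \<tau> a < \<tau> b" if "a \<in> {1..k}" "b \<in> {1..k}" for a b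
  proof -
    have "\<tau> a - 1 < k" "\<tau> b - 1 < k" "\<tau> a - 1 < \<tau> b - 1 \<longleftrightarrow> \<tau> a < \<tau> b"
      using t[OF that(1)] t[OF that(2)] by auto
    then show ?thesis
      unfolding i_def permutes_inverses(1)[OF assms(1)] using jless by blast
  qed
  ultimately show ?l unfolding contains_pattern_def by blast
qed

section \<open>Occurrences of the two patterns in the key word\<close>

lemma map_pattern_swap_last:
  assumes "length vs = k - 2" "k \<ge> 2"
  shows "map (\<lambda>a. (vs @ [x, y]) ! (pattern_swap_last k a - 1)) [1..<Suc k] = vs @ [y, x]"
proof (rule nth_equalityI)
  fix i assume "i < length (map (\<lambda>a. (vs @ [x, y]) ! (pattern_swap_last k a - 1)) [1..<Suc k])"
  then have i: "i < k" by (simp del: upt_Suc)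
  then have "map (\<lambda>a. (vs @ [x, y]) ! (pattern_swap_last k a - 1)) [1..<Suc k] ! i =
      (vs @ [x, y]) ! (pattern_swap_last k (Suc i) - 1)"
    by (subst nth_map) (auto simp del: upt_Suc)
  moreover consider "i < k - 2" | "i = k - 2" | "i = k - 1" using i by linarith
  then have "(vs @ [x, y]) ! (pattern_swap_last k (Suc i) - 1) = (vs @ [y, x]) ! i"
    by cases (use assms in \<open>auto simp: pattern_swap_last_def nth_append\<close>)
  ultimately show "map (\<lambda>a. (vs @ [x, y]) ! (pattern_swap_last k a - 1)) [1..<Suc k] ! i = (vs @ [y, x]) ! i"
    by simp
qed (use assms in \<open>simp del: upt_Suc\<close>)

lemma map_pattern_shift:
  assumes "length us = k - 1" "k \<ge> 1"
  shows "map (\<lambda>a. (x # us) ! (pattern_shift k a - 1)) [1..<Suc k] = us @ [x]"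
proof (rule nth_equalityI)
  fix i assume "i < length (map (\<lambda>a. (x # us) ! (pattern_shift k a - 1)) [1..<Suc k])"
  then have i: "i < k" by (simp del: upt_Suc)
  then have "map (\<lambda>a. (x # us) ! (pattern_shift k a - 1)) [1..<Suc k] ! i =
      (x # us) ! (pattern_shift k (Suc i) - 1)"
    by (subst nth_map) (auto simp del: upt_Suc)
  moreover have "(x # us) ! (pattern_shift k (Suc i) - 1) = (us @ [x]) ! i"
    using i assms by (cases "i = k - 1") (auto simp: pattern_shift_def nth_append)
  ultimately show "map (\<lambda>a. (x # us) ! (pattern_shift k a - 1)) [1..<Suc k] ! i = (us @ [x]) ! i"
    by simp
qed (use assms in \<open>simp del: upt_Suc\<close>)

lemma subseq_map_upt_iff:
  "subseq s (map f [1..<Suc n]) \<longleftrightarrow> (\<exists>js. sorted_wrt (<) js \<and> set js \<subseteq> {1..n} \<and> s = map f js)"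
proof
  assume "subseq s (map f [1..<Suc n])"
  then obtain N where "s = map f (nths [1..<Suc n] N)"
    by (auto simp: subseq_conv_nths nths_map simp del: upt_Suc)
  moreover have "sorted_wrt (<) (nths [1..<Suc n] N)"
    by (simp add: strict_sorted_iff sorted_nths del: upt_Suc)
  moreover have "set (nths [1..<Suc n] N) \<subseteq> {1..n}"
    using set_nths_subset[of "[1..<Suc n]" N] by auto
  ultimately show "\<exists>js. sorted_wrt (<) js \<and> set js \<subseteq> {1..n} \<and> s = map f js" by blast
next
  assume "\<exists>js. sorted_wrt (<) js \<and> set js \<subseteq> {1..n} \<and> s = map f js"
  then obtain js where js: "sorted_wrt (<) js" "set js \<subseteq> {1..n}" "s = map f js" by blast
  have "js = filter (\<lambda>x. x \<in> set js) [1..<Suc n]"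
    using js(1,2) by (intro sorted_distinct_set_unique) (auto simp: strict_sorted_iff sorted_wrt_filter simp del: upt_Suc)
  then have "subseq js [1..<Suc n]" by (metis subseq_filter_left)
  then show "subseq s (map f [1..<Suc n])" unfolding js(3) by (rule subseq_map)
qed

context
  fixes n :: nat and S :: "nat set" and \<pi> :: "nat \<Rightarrow> nat"
  assumes perm: "\<pi> permutes {1..n}" and desc: "descent_set n \<pi> \<subseteq> S" and fin: "finite S"
begin

text \<open>Inside a block the smaller value comes first, so equal blocks are allowed here and
  excluded in \<open>inv_less_less\<close>.\<close>

lemma inv_less_le: "u \<in> {1..n} \<Longrightarrow> v \<in> {1..n} \<Longrightarrow> u < v \<Longrightarrow>
    inv \<pi> u < inv \<pi> v \<longleftrightarrow> block S (inv \<pi> u) \<le> block S (inv \<pi> v)"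
  using inv_less_iff[OF perm desc fin, of u v] by auto

lemma inv_less_less: "u \<in> {1..n} \<Longrightarrow> v \<in> {1..n} \<Longrightarrow> v < u \<Longrightarrow>
    inv \<pi> u < inv \<pi> v \<longleftrightarrow> block S (inv \<pi> u) < block S (inv \<pi> v)"
  using inv_less_iff[OF perm desc fin, of u v] by auto

lemma sorted_wrt_inv:
  "sorted_wrt (<) vs \<Longrightarrow> set vs \<subseteq> {1..n} \<Longrightarrow>
    sorted_wrt (\<lambda>u v. inv \<pi> u < inv \<pi> v) vs \<longleftrightarrow> sorted_wrt (\<le>) (map (\<lambda>v. block S (inv \<pi> v)) vs)"
proof (induction vs)
  case (Cons u vs)
  have "inv \<pi> u < inv \<pi> v \<longleftrightarrow> block S (inv \<pi> u) \<le> block S (inv \<pi> v)" if "v \<in> set vs" for v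
    using Cons.prems that by (intro inv_less_le) auto
  then show ?case using Cons by simp
qed simp

text \<open>The two largest values \<open>x < y\<close> stand in the opposite order, which makes
  their blocks differ strictly; all other comparisons agree with the order of values and become
  weak.\<close>

lemma contains_swap_last_iff:
  assumes "k \<ge> 2"
  shows "contains_pattern n \<pi> k (pattern_swap_last k) \<longleftrightarrow> \<not> avoids_desc (k - 2) (key_word n S \<pi>)"
proof -
  let ?L = "\<lambda>v. block S (inv \<pi> v)"
  have "contains_pattern n \<pi> k (pattern_swap_last k) \<longleftrightarrow>
    (\<exists>vs x y. length vs = k - 2 \<and> sorted_wrt (<) (vs @ [x, y]) \<and> set (vs @ [x, y]) \<subseteq> {1..n} \<and>
       sorted_wrt (\<lambda>u v. inv \<pi> u < inv \<pi> v) (vs @ [y, x]))" (is "?c \<longleftrightarrow> ?m")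
  proof
    assume ?c
    then obtain js where js: "length js = k" "sorted_wrt (<) js" "set js \<subseteq> {1..n}"
      "sorted_wrt (\<lambda>u v. inv \<pi> u < inv \<pi> v) (map (\<lambda>a. js ! (pattern_swap_last k a - 1)) [1..<Suc k])"
      using contains_pattern_iff[OF perm pattern_swap_last_permutes[OF assms]] by blast
    define vs where "vs = take (k - 2) js"
    have "length (drop (k - 2) js) = 2" using js(1) assms by simp
    then obtain x y where "drop (k - 2) js = [x, y]"
      unfolding numeral_2_eq_2 length_Suc_conv length_0_conv by blast
    then have v: "js = vs @ [x, y]" unfolding vs_def by (metis append_take_drop_id)
    have "length vs = k - 2" using js(1) by (simp add: vs_def)
    then show ?m using js(2-4) map_pattern_swap_last[OF _ assms, of vs x y] unfolding v by metis
  next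
    assume ?m
    then obtain vs x y where v: "length vs = k - 2" "sorted_wrt (<) (vs @ [x, y])" "set (vs @ [x, y]) \<subseteq> {1..n}"
       "sorted_wrt (\<lambda>u v. inv \<pi> u < inv \<pi> v) (vs @ [y, x])" by blast
    have "length (vs @ [x, y]) = k" using v(1) assms by simp
    then show ?c
      unfolding contains_pattern_iff[OF perm pattern_swap_last_permutes[OF assms]]
      using v map_pattern_swap_last[OF v(1) assms, of x y] by metis
  qed
  also have "\<dots> \<longleftrightarrow>
    (\<exists>vs x y. length vs = k - 2 \<and> sorted_wrt (<) (vs @ [x, y]) \<and> set (vs @ [x, y]) \<subseteq> {1..n} \<and>
       sorted_wrt (\<le>) (map ?L vs) \<and> (\<forall>v\<in>set vs. ?L v \<le> ?L y) \<and> ?L y < ?L x)"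
  proof -
    have "sorted_wrt (\<lambda>u v. inv \<pi> u < inv \<pi> v) (vs @ [y, x]) \<longleftrightarrow>
       sorted_wrt (\<le>) (map ?L vs) \<and> (\<forall>v\<in>set vs. ?L v \<le> ?L y) \<and> ?L y < ?L x"
      if s: "sorted_wrt (<) (vs @ [x, y])" "set (vs @ [x, y]) \<subseteq> {1..n}" for vs x y
    proof -
      have "inv \<pi> v < inv \<pi> y \<longleftrightarrow> ?L v \<le> ?L y" if "v \<in> set vs" for v
        using s that by (intro inv_less_le) (auto simp: sorted_wrt_append)
      moreover have "inv \<pi> y < inv \<pi> x \<longleftrightarrow> ?L y < ?L x"
        using s by (intro inv_less_less) (auto simp: sorted_wrt_append)
      moreover have "sorted_wrt (\<lambda>u v. inv \<pi> u < inv \<pi> v) vs \<longleftrightarrow> sorted_wrt (\<le>) (map ?L vs)"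
        using s by (intro sorted_wrt_inv) (auto simp: sorted_wrt_append)
      moreover have "sorted_wrt (\<lambda>u v. inv \<pi> u < inv \<pi> v) (vs @ [y, x]) \<longleftrightarrow>
         sorted_wrt (\<lambda>u v. inv \<pi> u < inv \<pi> v) vs \<and> (\<forall>v\<in>set vs. inv \<pi> v < inv \<pi> y) \<and> inv \<pi> y < inv \<pi> x"
        by (auto simp: sorted_wrt_append)
      ultimately show ?thesis by auto
    qed
    then show ?thesis by blast
  qed
  also have "\<dots> \<longleftrightarrow> \<not> avoids_desc (k - 2) (key_word n S \<pi>)" (is "?m \<longleftrightarrow> ?r")
  proof
    assume ?m
    then obtain vs x y where v: "length vs = k - 2" "sorted_wrt (<) (vs @ [x, y])" "set (vs @ [x, y]) \<subseteq> {1..n}"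
      "sorted_wrt (\<le>) (map ?L vs)" "\<forall>v\<in>set vs. ?L v \<le> ?L y" "?L y < ?L x" by blast
    have "subseq (map ?L (vs @ [x, y])) (key_word n S \<pi>)"
      unfolding key_word_def subseq_map_upt_iff using v(2,3) by blast
    then have "subseq (map ?L vs @ [?L x, ?L y]) (key_word n S \<pi>)" by simp
    moreover have "length (map ?L vs) = k - 2" "\<forall>a\<in>set (map ?L vs). a \<le> ?L y" using v by auto
    ultimately show ?r unfolding avoids_desc_def using v(4,6) by blast
  next
    assume ?r
    then obtain s b a where s: "subseq (s @ [b, a]) (key_word n S \<pi>)" "sorted_wrt (\<le>) s"
      "length s = k - 2" "\<forall>x\<in>set s. x \<le> a" "a < b" unfolding avoids_desc_def by blast
    from s(1) obtain js where js: "sorted_wrt (<) js" "set js \<subseteq> {1..n}" "s @ [b, a] = map ?L js"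
      unfolding key_word_def subseq_map_upt_iff by blast
    then obtain vs x y where v: "js = vs @ [x, y]" "map ?L vs = s" "?L x = b" "?L y = a"
      by (auto simp: append_eq_map_conv)
    then show ?m using s js by (metis (no_types, lifting) length_map image_eqI list.set_map)
  qed
  finally show ?thesis .
qed

text \<open>The smallest value \<open>x\<close> stands last, so its block is strictly larger than
  all the others, while those increase weakly.\<close>

lemma contains_shift_iff:
  assumes "k \<ge> 1"
  shows "contains_pattern n \<pi> k (pattern_shift k) \<longleftrightarrow> \<not> avoids (\<le>) (k - 1) (key_word n S \<pi>)"
proof -
  let ?L = "\<lambda>v. block S (inv \<pi> v)"
  have "contains_pattern n \<pi> k (pattern_shift k) \<longleftrightarrow>
    (\<exists>us x. length us = k - 1 \<and> sorted_wrt (<) (x # us) \<and> set (x # us) \<subseteq> {1..n} \<and>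
       sorted_wrt (\<lambda>u v. inv \<pi> u < inv \<pi> v) (us @ [x]))" (is "?c \<longleftrightarrow> ?m")
  proof
    assume ?c
    then obtain js where js: "length js = k" "sorted_wrt (<) js" "set js \<subseteq> {1..n}"
      "sorted_wrt (\<lambda>u v. inv \<pi> u < inv \<pi> v) (map (\<lambda>a. js ! (pattern_shift k a - 1)) [1..<Suc k])"
      using contains_pattern_iff[OF perm pattern_shift_permutes[OF assms]] by blast
    obtain x us where v: "js = x # us" using js(1) assms by (cases js) auto
    have "length us = k - 1" using js(1) v by simp
    then show ?m using js(2-4) map_pattern_shift[OF _ assms, of us x] unfolding v by metis
  next
    assume ?m
    then obtain us x where v: "length us = k - 1" "sorted_wrt (<) (x # us)" "set (x # us) \<subseteq> {1..n}"
       "sorted_wrt (\<lambda>u v. inv \<pi> u < inv \<pi> v) (us @ [x])" by blast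
    have "length (x # us) = k" using v(1) assms by simp
    then show ?c
      unfolding contains_pattern_iff[OF perm pattern_shift_permutes[OF assms]]
      using v map_pattern_shift[OF v(1) assms, of x] by metis
  qed
  also have "\<dots> \<longleftrightarrow>
    (\<exists>us x. length us = k - 1 \<and> sorted_wrt (<) (x # us) \<and> set (x # us) \<subseteq> {1..n} \<and>
       sorted_wrt (\<le>) (map ?L us) \<and> (\<forall>u\<in>set us. ?L u < ?L x))"
  proof -
    have "sorted_wrt (\<lambda>u v. inv \<pi> u < inv \<pi> v) (us @ [x]) \<longleftrightarrow>
       sorted_wrt (\<le>) (map ?L us) \<and> (\<forall>u\<in>set us. ?L u < ?L x)"
      if s: "sorted_wrt (<) (x # us)" "set (x # us) \<subseteq> {1..n}" for us x
    proof -
      have "inv \<pi> u < inv \<pi> x \<longleftrightarrow> ?L u < ?L x" if "u \<in> set us" for u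
        using s that by (intro inv_less_less) auto
      moreover have "sorted_wrt (\<lambda>u v. inv \<pi> u < inv \<pi> v) us \<longleftrightarrow> sorted_wrt (\<le>) (map ?L us)"
        using s by (intro sorted_wrt_inv) auto
      ultimately show ?thesis by (auto simp: sorted_wrt_append)
    qed
    then show ?thesis by blast
  qed
  also have "\<dots> \<longleftrightarrow> \<not> avoids (\<le>) (k - 1) (key_word n S \<pi>)" (is "?m \<longleftrightarrow> ?r")
  proof
    assume ?m
    then obtain us x where v: "length us = k - 1" "sorted_wrt (<) (x # us)" "set (x # us) \<subseteq> {1..n}"
      "sorted_wrt (\<le>) (map ?L us)" "\<forall>u\<in>set us. ?L u < ?L x" by blast
    have "subseq (map ?L (x # us)) (key_word n S \<pi>)"
      unfolding key_word_def subseq_map_upt_iff using v(2,3) by blast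
    then have "subseq (?L x # map ?L us) (key_word n S \<pi>)" by simp
    moreover have "length (map ?L us) = k - 1" "\<forall>a\<in>set (map ?L us). a < ?L x" using v by auto
    ultimately show ?r unfolding avoids_def using v(4) by blast
  next
    assume ?r
    then obtain b s where s: "subseq (b # s) (key_word n S \<pi>)" "sorted_wrt (\<le>) s"
      "length s = k - 1" "\<forall>x\<in>set s. x < b" unfolding avoids_def by blast
    from s(1) obtain js where js: "sorted_wrt (<) js" "set js \<subseteq> {1..n}" "b # s = map ?L js"
      unfolding key_word_def subseq_map_upt_iff by (elim exE conjE) (rule that)
    then obtain us x where v: "js = x # us" "map ?L us = s" "?L x = b" by (cases js) auto
    have "length us = k - 1" "sorted_wrt (\<le>) (map ?L us)" "\<forall>u\<in>set us. ?L u < ?L x"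
      using s(2-4) v(2,3) by auto
    then show ?m using js(1,2) unfolding v(1) by blast
  qed
  finally show ?thesis .
qed

end

text \<open>Recovers \<open>inv \<pi>\<close> from the order of positions alone, as needed for the
  injectivity of \<open>key_word\<close>.\<close>

lemma card_inv_less:
  assumes "\<pi> permutes {1..n}" "u \<in> {1..n}"
  shows "card {v \<in> {1..n}. inv \<pi> v < inv \<pi> u} = inv \<pi> u - 1"
proof -
  note p = permutes_inv[OF assms(1)]
  have u: "inv \<pi> u \<in> {1..n}" using permutes_in_image[OF p] assms(2) by blast
  have "inv \<pi> ` {v \<in> {1..n}. inv \<pi> v < inv \<pi> u} = {1..<inv \<pi> u}"
  proof (intro set_eqI iffI)
    fix i assume "i \<in> {1..<inv \<pi> u}"
    then have "i \<in> {1..n}" "i < inv \<pi> u" using u by auto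
    moreover from this have "\<pi> i \<in> {1..n}" using permutes_in_image[OF assms(1)] by blast
    ultimately show "i \<in> inv \<pi> ` {v \<in> {1..n}. inv \<pi> v < inv \<pi> u}"
      using permutes_inverses(2)[OF assms(1), of i] by (intro image_eqI[of _ _ "\<pi> i"]) auto
  next
    fix i assume "i \<in> inv \<pi> ` {v \<in> {1..n}. inv \<pi> v < inv \<pi> u}"
    then obtain v where "v \<in> {1..n}" "i = inv \<pi> v" "i < inv \<pi> u" by auto
    moreover from this have "i \<in> {1..n}" using permutes_in_image[OF p] by blast
    ultimately show "i \<in> {1..<inv \<pi> u}" by simp
  qed
  moreover have "inj_on (inv \<pi>) {v \<in> {1..n}. inv \<pi> v < inv \<pi> u}"
    using permutes_inj_on[OF p] .
  ultimately show ?thesis by (metis card_atLeastLessThan card_image)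
qed

lemma key_word_inj:
  assumes "finite S"
  shows "inj_on (key_word n S) {\<pi>. \<pi> permutes {1..n} \<and> descent_set n \<pi> \<subseteq> S}"
proof (rule inj_onI)
  fix \<pi> \<sigma>
  assume "\<pi> \<in> {\<pi>. \<pi> permutes {1..n} \<and> descent_set n \<pi> \<subseteq> S}"
    "\<sigma> \<in> {\<pi>. \<pi> permutes {1..n} \<and> descent_set n \<pi> \<subseteq> S}" and eq: "key_word n S \<pi> = key_word n S \<sigma>"
  then have p: "\<pi> permutes {1..n}" "descent_set n \<pi> \<subseteq> S" and s: "\<sigma> permutes {1..n}" "descent_set n \<sigma> \<subseteq> S" by auto
  have L: "block S (inv \<pi> v) = block S (inv \<sigma> v)" if "v \<in> {1..n}" for v
    using eq that unfolding key_word_def by (auto simp: map_eq_conv simp del: upt_Suc)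
  have less: "inv \<pi> u < inv \<pi> v \<longleftrightarrow> inv \<sigma> u < inv \<sigma> v" if "u \<in> {1..n}" "v \<in> {1..n}" for u v
    using inv_less_iff[OF p assms that] inv_less_iff[OF s assms that] L that by simp
  have "inv \<pi> u = inv \<sigma> u" for u
  proof (cases "u \<in> {1..n}")
    case True
    have "{v \<in> {1..n}. inv \<pi> v < inv \<pi> u} = {v \<in> {1..n}. inv \<sigma> v < inv \<sigma> u}" using less True by blast
    then have "inv \<pi> u - 1 = inv \<sigma> u - 1"
      using card_inv_less[OF p(1) True] card_inv_less[OF s(1) True] by simp
    moreover have "inv \<pi> u \<in> {1..n}" "inv \<sigma> u \<in> {1..n}"
      using permutes_in_image[OF permutes_inv[OF p(1)]] permutes_in_image[OF permutes_inv[OF s(1)]] True by blast+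
    ultimately show ?thesis by auto
  next
    case False
    then show ?thesis using permutes_inv[OF p(1)] permutes_inv[OF s(1)] by (simp add: permutes_not_in)
  qed
  then have "inv \<pi> = inv \<sigma>" by blast
  then show "\<pi> = \<sigma>" using permutes_inv_inv[OF p(1)] permutes_inv_inv[OF s(1)] by metis
qed

lemma mset_key_word:
  assumes "\<pi> permutes {1..n}"
  shows "mset (key_word n S \<pi>) = mset (map (block S) [1..<Suc n])"
proof -
  have "mset [1..<Suc n] = mset_set {1..n}"
    by (metis atLeastLessThanSuc_atLeastAtMost mset_upt)
  moreover have "image_mset (inv \<pi>) (mset_set {1..n}) = mset_set {1..n}"
    using image_mset_mset_set[OF permutes_inj_on[OF permutes_inv[OF assms]], of "{1..n}"]
      permutes_image[OF permutes_inv[OF assms]] by simp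
  ultimately have "image_mset (inv \<pi>) (mset [1..<Suc n]) = mset [1..<Suc n]" by simp
  then have "image_mset (block S) (image_mset (inv \<pi>) (mset [1..<Suc n])) = image_mset (block S) (mset [1..<Suc n])"
    by simp
  then show ?thesis unfolding key_word_def mset_map by (simp add: image_mset.compositionality comp_def del: upt_Suc)
qed

text \<open>\<open>\<pi>\<close> lists the values sorted by their letters. Stability of the sorting
  keeps values with equal letters increasing, which excludes descents inside a block.\<close>

lemma key_word_surj:
  assumes "finite S" "mset w = mset (map (block S) [1..<Suc n])"
  shows "\<exists>\<pi>. \<pi> permutes {1..n} \<and> descent_set n \<pi> \<subseteq> S \<and> key_word n S \<pi> = w"
proof -
  have lw: "length w = n" using arg_cong[OF assms(2), of size] by simp
  define f where "f v = w ! (v - 1)" for v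
  define l where "l = sort_key f [1..<Suc n]"
  define \<pi> where "\<pi> i = (if i \<in> {1..n} then l ! (i - 1) else i)" for i
  have l: "length l = n" "distinct l" "set l = {1..n}" by (auto simp: l_def simp del: upt_Suc)
  have "bij_betw (\<lambda>i. i - 1) {1..n} {..<n}"
    by (rule bij_betw_byWitness[where f' = Suc]) auto
  moreover have "bij_betw ((!) l) {..<n} {1..n}"
    using l by (intro bij_betw_nth) auto
  ultimately have "bij_betw ((!) l \<circ> (\<lambda>i. i - 1)) {1..n} {1..n}" by (rule bij_betw_trans)
  then have "bij_betw \<pi> {1..n} {1..n}"
    by (rule bij_betw_cong[THEN iffD1, rotated]) (auto simp: \<pi>_def)
  then have perm: "\<pi> permutes {1..n}" by (rule bij_imp_permutes) (auto simp: \<pi>_def)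
  have fw: "map f [1..<Suc n] = w"
    by (rule nth_equalityI) (auto simp: lw f_def simp del: upt_Suc)
  have keys: "map f l = map (block S) [1..<Suc n]"
  proof -
    have "mset (map f l) = mset (map f [1..<Suc n])" by (simp add: l_def del: upt_Suc)
    then have "mset (map f l) = mset (map (block S) [1..<Suc n])" unfolding fw assms(2) .
    moreover have "sorted (map f l)" by (simp add: l_def)
    moreover have "sorted (map (block S) [1..<Suc n])"
      unfolding sorted_map using block_mono[OF assms(1)]
        sorted_wrt_mono_rel[of "[1..<Suc n]" "(\<le>)" "\<lambda>x y. block S x \<le> block S y"]
      by (simp del: upt_Suc)
    ultimately show ?thesis by (metis properties_for_sort)
  qed
  have key: "f (\<pi> i) = block S i" if "i \<in> {1..n}" for i
  proof -
    have "f (\<pi> i) = map f l ! (i - 1)" using that l(1) by (auto simp: \<pi>_def)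
    also have "\<dots> = map (block S) [1..<Suc n] ! (i - 1)" by (simp only: keys)
    also have "\<dots> = block S i" using that by (subst nth_map) (auto simp del: upt_Suc)
    finally show ?thesis .
  qed
  have "key_word n S \<pi> = map f [1..<Suc n]"
    unfolding key_word_def
  proof (rule map_cong[OF refl])
    fix v assume "v \<in> set [1..<Suc n]"
    then have "inv \<pi> v \<in> {1..n}" using permutes_in_image[OF permutes_inv[OF perm], of v] by auto
    then show "block S (inv \<pi> v) = f v" using key[of "inv \<pi> v"] permutes_inverses(1)[OF perm] by simp
  qed
  then have "key_word n S \<pi> = w" using fw by simp
  moreover have "descent_set n \<pi> \<subseteq> S"
  proof (rule subsetI, rule ccontr)
    fix i assume i: "i \<in> descent_set n \<pi>" "i \<notin> S"
    then have i1: "1 \<le> i" "i < n" "\<pi> (Suc i) < \<pi> i" by (auto simp: descent_set_def)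
    \<comment> \<open>A descent inside a block would put two decreasing neighbours into the sublist
      of values with this letter, but that sublist is increasing.\<close>
    let ?P = "\<lambda>y. f y = block S i"
    have P: "?P (\<pi> i)" "?P (\<pi> (Suc i))" using key[of i] key[of "Suc i"] i1 block_Suc[OF i(2)] by auto
    have "drop (i - 1) l = \<pi> i # \<pi> (Suc i) # drop (Suc i) l"
      using i1 l(1) Cons_nth_drop_Suc[of "i - 1" l] Cons_nth_drop_Suc[of i l] by (simp add: \<pi>_def)
    then have "l = take (i - 1) l @ \<pi> i # \<pi> (Suc i) # drop (Suc i) l"
      using append_take_drop_id[of "i - 1" l] by simp
    then have "filter ?P l = filter ?P (take (i - 1) l @ \<pi> i # \<pi> (Suc i) # drop (Suc i) l)"
      by (rule arg_cong)
    also have "\<dots> = filter ?P (take (i - 1) l) @ \<pi> i # \<pi> (Suc i) # filter ?P (drop (Suc i) l)"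
      using P by simp
    finally have "filter ?P l = filter ?P (take (i - 1) l) @ \<pi> i # \<pi> (Suc i) # filter ?P (drop (Suc i) l)" .
    moreover have "filter ?P l = filter ?P [1..<Suc n]" unfolding l_def by (rule sort_key_stable)
    moreover have "sorted_wrt (<) (filter ?P [1..<Suc n])"
      by (simp add: strict_sorted_iff sorted_wrt_filter del: upt_Suc)
    ultimately have "\<pi> i < \<pi> (Suc i)" by (simp add: sorted_wrt_append)
    then show False using i1 by simp
  qed
  ultimately show ?thesis using perm by blast
qed

lemma bij_betw_key_word:
  assumes "finite S"
  shows "bij_betw (key_word n S) {\<pi>. \<pi> permutes {1..n} \<and> descent_set n \<pi> \<subseteq> S}
    {w. mset w = mset (map (block S) [1..<Suc n])}"
proof -
  have "key_word n S ` {\<pi>. \<pi> permutes {1..n} \<and> descent_set n \<pi> \<subseteq> S} =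
    {w. mset w = mset (map (block S) [1..<Suc n])}"
  proof (intro set_eqI iffI)
    fix w assume "w \<in> key_word n S ` {\<pi>. \<pi> permutes {1..n} \<and> descent_set n \<pi> \<subseteq> S}"
    then show "w \<in> {w. mset w = mset (map (block S) [1..<Suc n])}"
      using mset_key_word by blast
  next
    fix w assume "w \<in> {w. mset w = mset (map (block S) [1..<Suc n])}"
    then show "w \<in> key_word n S ` {\<pi>. \<pi> permutes {1..n} \<and> descent_set n \<pi> \<subseteq> S}"
      using key_word_surj[OF assms, of w n] by blast
  qed
  then show ?thesis using key_word_inj[OF assms] by (simp add: bij_betw_def)
qed

lemma avoiders_eqpoll_words:
  assumes "finite S" and "\<And>\<pi>. \<pi> permutes {1..n} \<Longrightarrow> descent_set n \<pi> \<subseteq> S \<Longrightarrow>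
      contains_pattern n \<pi> k \<tau> \<longleftrightarrow> \<not> Q (key_word n S \<pi>)"
  shows "{\<pi> \<in> avoiders n k \<tau>. descent_set n \<pi> \<subseteq> S} \<approx> {w. mset w = mset (map (block S) [1..<Suc n]) \<and> Q w}"
proof -
  note b = bij_betw_key_word[OF assms(1), of n]
  have "key_word n S ` {\<pi> \<in> avoiders n k \<tau>. descent_set n \<pi> \<subseteq> S} =
      {w. mset w = mset (map (block S) [1..<Suc n]) \<and> Q w}" (is "_ ` ?A = ?B")
  proof (intro set_eqI iffI)
    fix w assume "w \<in> key_word n S ` ?A"
    then show "w \<in> ?B" using assms(2) mset_key_word by (auto simp: avoiders_def simp del: upt_Suc)
  next
    fix w assume w: "w \<in> ?B"
    then obtain \<pi> where "\<pi> permutes {1..n}" "descent_set n \<pi> \<subseteq> S" "key_word n S \<pi> = w"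
      using key_word_surj[OF assms(1), of w n] by blast
    then show "w \<in> key_word n S ` ?A" using assms(2)[of \<pi>] w by (auto simp: avoiders_def)
  qed
  moreover have "inj_on (key_word n S) ?A"
    by (rule inj_on_subset[OF key_word_inj[OF assms(1)]]) (auto simp: avoiders_def)
  ultimately show ?thesis unfolding eqpoll_def bij_betw_def by blast
qed

text \<open>The inclusion-exclusion step as a triangular system: the elements with
  \<open>D x \<subseteq> S\<close> are split by the value of \<open>D\<close>, and proper subsets of
  \<open>S\<close> are settled by induction.\<close>

lemma card_fibers_eq:
  fixes D :: "'a \<Rightarrow> 'b set"
  assumes "finite A" "finite B" "\<And>S. finite S \<Longrightarrow> card {x \<in> A. D x \<subseteq> S} = card {x \<in> B. D x \<subseteq> S}"
    and "finite S"
  shows "card {x \<in> A. D x = S} = card {x \<in> B. D x = S}"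
  using assms(4)
proof (induction S rule: finite_psubset_induct)
  case (psubset S)
  have split: "card {x \<in> X. D x \<subseteq> S} = card {x \<in> X. D x = S} + (\<Sum>U\<in>Pow S - {S}. card {x \<in> X. D x = U})"
    if "finite X" for X
  proof -
    have "D ` {x \<in> X. D x \<subseteq> S} \<subseteq> Pow S" by auto
    then have "card {x \<in> X. D x \<subseteq> S} = (\<Sum>U\<in>Pow S. \<Sum>x | x \<in> {x \<in> X. D x \<subseteq> S} \<and> D x = U. 1)"
      using sum.group[of "{x \<in> X. D x \<subseteq> S}" "Pow S" D "\<lambda>_. 1::nat"] that psubset.hyps by auto
    also have "\<dots> = (\<Sum>U\<in>Pow S. card {x \<in> X. D x = U})"
      by (intro sum.cong) (auto intro!: arg_cong[where f = card])
    also have "\<dots> = card {x \<in> X. D x = S} + (\<Sum>U\<in>Pow S - {S}. card {x \<in> X. D x = U})"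
      using psubset.hyps by (intro sum.remove) auto
    finally show ?thesis .
  qed
  have "(\<Sum>U\<in>Pow S - {S}. card {x \<in> A. D x = U}) = (\<Sum>U\<in>Pow S - {S}. card {x \<in> B. D x = U})"
    by (intro sum.cong psubset.IH) auto
  then show ?case using split[OF assms(1)] split[OF assms(2)] assms(3)[OF psubset.hyps] by simp
qed

text \<open>Bijections between fibres glue to one map, since \<open>D x\<close> tells which of them
  to apply.\<close>

lemma bij_betw_preserving:
  assumes "finite A" "finite B" "\<And>x. x \<in> A \<union> B \<Longrightarrow> finite (D x)"
    "\<And>S. finite S \<Longrightarrow> card {x \<in> A. D x = S} = card {x \<in> B. D x = S}"
  shows "\<exists>f. bij_betw f A B \<and> (\<forall>x\<in>A. D (f x) = D x)"
proof -
  have "\<exists>f. bij_betw f {x \<in> A. D x = S} {x \<in> B. D x = S}" for S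
  proof (cases "finite S")
    case True
    then show ?thesis using assms by (intro finite_same_card_bij) auto
  next
    case False
    then have e: "{x \<in> A. D x = S} = {}" "{x \<in> B. D x = S} = {}" using assms(3) by auto
    show ?thesis unfolding e by (simp add: bij_betw_def)
  qed
  then obtain F where F: "\<And>S. bij_betw (F S) {x \<in> A. D x = S} {x \<in> B. D x = S}" by metis
  define f where "f x = F (D x) x" for x
  have f: "f x \<in> B \<and> D (f x) = D x" if "x \<in> A" for x
    using bij_betw_apply[OF F[of "D x"], of x] that by (simp add: f_def)
  have "inj_on f A"
  proof (rule inj_onI)
    fix x y assume xy: "x \<in> A" "y \<in> A" "f x = f y"
    then have "D x = D y" using f by metis
    then show "x = y" using xy F[of "D x"] by (auto simp: f_def bij_betw_def inj_on_def)
  qed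
  moreover have "B \<subseteq> f ` A"
  proof
    fix y assume "y \<in> B"
    then have "y \<in> F (D y) ` {x \<in> A. D x = D y}" using F[of "D y"] by (auto simp: bij_betw_def)
    then obtain x where x: "x \<in> A" "D x = D y" "y = F (D y) x" by auto
    then have "f x = y" by (simp add: f_def)
    then show "y \<in> f ` A" using x(1) by blast
  qed
  ultimately show ?thesis using f unfolding bij_betw_def by blast
qed

theorem theorem1:
  fixes k n :: nat
  assumes "k \<ge> 3" and "n \<ge> 1"
  shows "\<exists>\<Theta> :: (nat \<Rightarrow> nat) \<Rightarrow> (nat \<Rightarrow> nat).
           bij_betw \<Theta> (avoiders n k (pattern_swap_last k)) (avoiders n k (pattern_shift k)) \<and>
           (\<forall>\<pi> \<in> avoiders n k (pattern_swap_last k). descent_set n (\<Theta> \<pi>) = descent_set n \<pi>)"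
proof -
  let ?A = "avoiders n k (pattern_swap_last k)" and ?B = "avoiders n k (pattern_shift k)"
  have finD: "finite (descent_set n \<pi>)" for \<pi>
    by (rule finite_subset[of _ "{..n}"]) (auto simp: descent_set_def)
  have fin: "finite ?A" "finite ?B"
    using finite_permutations[of "{1..n}"] by (auto simp: avoiders_def)
  have k: "k \<ge> 2" "k \<ge> 1" "Suc (k - 2) = k - 1" using assms by auto
  have "card {\<pi> \<in> ?A. descent_set n \<pi> \<subseteq> S} = card {\<pi> \<in> ?B. descent_set n \<pi> \<subseteq> S}" if S: "finite S" for S
  proof -
    let ?C = "mset (map (block S) [1..<Suc n])"
    have "{\<pi> \<in> ?A. descent_set n \<pi> \<subseteq> S} \<approx> {w. mset w = ?C \<and> avoids_desc (k - 2) w}"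
      by (rule avoiders_eqpoll_words[OF S contains_swap_last_iff[OF _ _ S k(1)]])
    also have "\<dots> \<approx> {w. mset w = ?C \<and> avoids (\<le>) (k - 1) w}"
      using avoids_desc_le[of ?C "k - 2"] unfolding k(3) .
    also have "\<dots> \<approx> {\<pi> \<in> ?B. descent_set n \<pi> \<subseteq> S}"
      by (rule eqpoll_sym, rule avoiders_eqpoll_words[OF S contains_shift_iff[OF _ _ S k(2)]])
    finally show ?thesis using fin by (subst (asm) eqpoll_iff_card) auto
  qed
  then show ?thesis using fin finD
    by (intro bij_betw_preserving card_fibers_eq) auto
qed

end
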